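(* Suppose that at least one of the following two conditions holds: (a) for almost all $u\in(0,1)$, $f(X_{N(1)},u)\to f(X_1,u)$ in probability as $n\to\infty$; (b) for all $k=1,\ldots,K$, the mapping $x\mapsto Q_k(x)$ is $P_X$-almost everywhere continuous. Then $\widehat\psi(X,Y)$ converges in probability to $\psi(X,Y)$ as $n\to\infty$.
   Context: $(\mathcal{H},d)$ is a separable metric space, $X$ is an $\mathcal{H}$-valued random variable with law $P_X$, and $Y$ is categorical with levels $\{1,\ldots,K\}$, $K\ge2$, $p_k=P(Y=k)>0$ for all $k$. $Q_k(x)=P(Y=k\mid X=x)$ and $f(x,u)=\min\{k\in\{1,\ldots,K\}:\sum_{j=1}^kQ_j(x)>u\}$. With $U,U'$ uniform on $(0,1)$ and $X,U,U'$ independent, one assumes (without changing the law of $(X,Y)$) $Y=f(X,U)$ and sets $Y'=f(X,U')$. With $p_{i,j}=P(Y=i,Y'=j)$, $$\psi(X,Y)=\frac1{K-1}\sum_{i,j=1}^K\frac{(p_{i,j}-p_ip_j)^2}{p_ip_j}.$$ Sample: $(X_i,U_i)$, $i\ge 1$, are i.i.d. copies of $(X,U)$ and $Y_i=f(X_i,U_i)$, so $(X_1,Y_1),\ldots,(X_n,Y_n)$ is an i.i.d. sample from the law of $(X,Y)$. $N(i)=N_n(i)\in\{1,\ldots,n\}\setminus\{i\}$ is the index of the nearest neighbour of $X_i$ among the other covariates $X_j$, $1\le j\le n$, $j\ne i$, with respect to $d$. It is assumed that $d(X_1,X_2)$ has a continuous distribution, so that nearest neighbours are almost surely unique. Set $$\widehat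 p_{k,l}=\frac1n\sum_{i=1}^n1\{Y_i=k,Y_{N(i)}=l\},\quad \widehat p_k=\sum_{l=1}^K\widehat p_{k,l},\quad \widehat q_l=\sum_{k=1}^K\widehat p_{k,l},$$ $$\widehat\psi(X,Y)=\frac{1}{K-1}\sum_{k,l=1}^K\frac{(\widehat p_{k,l}-\widehat p_k\widehat q_l)^2}{\widehat p_k\widehat q_l},$$ where summands with zero denominator are set to $0$. *)

theory Defs
  imports "HOL-Probability.Probability"
begin

definition tendsto_in_prob ::
    "'w measure \<Rightarrow> (nat \<Rightarrow> 'w \<Rightarrow> 'b::metric_space) \<Rightarrow> ('w \<Rightarrow> 'b) \<Rightarrow> bool" where
  "tendsto_in_prob M Z L \<longleftrightarrow>
     (\<forall>\<epsilon>>0. (\<lambda>n. \<P>(\<omega> in M. dist (Z n \<omega>) (L \<omega>) > \<epsilon>)) \<longlonglongrightarrow> 0)"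

text \<open>Mutual independence of three random variables with different value types, as mutual
  independence of the generated sigma-algebras (the library's \<open>indep_vars\<close> needs a common type).\<close>

definition indep3 ::
    "'w measure \<Rightarrow> ('w \<Rightarrow> 'a::topological_space) \<Rightarrow> ('w \<Rightarrow> 'b::topological_space)
      \<Rightarrow> ('w \<Rightarrow> 'c::topological_space) \<Rightarrow> bool" where
  "indep3 M X U V \<longleftrightarrow>
     prob_space.indep_sets M
       (\<lambda>i::nat. if i = 0 then sets (vimage_algebra (space M) X borel)
                else if i = 1 then sets (vimage_algebra (space M) U borel)
                else sets (vimage_algebra (space M) V borel)) {0, 1, 2}"

text \<open>\<open>q\<close> is a version of the conditional probability \<open>x \<mapsto> P(Y = k | X = x)\<close>: it is a Borel
  function whose composition with \<open>X\<close> is a conditional expectation of the indicator of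
  \<open>{Y = k}\<close> given the sigma-algebra generated by \<open>X\<close>.  Only almost sure equality is
  required, so versions \<open>Q 1, \<dots>, Q K\<close> for the levels of \<open>Y\<close> form
  a probability vector at almost every \<open>x\<close> (with respect to the law of \<open>X\<close>).\<close>

definition cond_prob_version ::
    "'w measure \<Rightarrow> ('w \<Rightarrow> 'a::topological_space) \<Rightarrow> ('w \<Rightarrow> nat) \<Rightarrow> nat \<Rightarrow> ('a \<Rightarrow> real) \<Rightarrow> bool" where
  "cond_prob_version M X Y k q \<longleftrightarrow>
     q \<in> borel_measurable borel \<and>
     (AE \<omega> in M. q (X \<omega>) =
        real_cond_exp M (vimage_algebra (space M) X borel)
          (indicator {\<omega> \<in> space M. Y \<omega> = k}) \<omega>)"

text \<open>The set below is nonempty whenever \<open>u < 1\<close> and the values \<open>Q 1 x, \<dots>, Q K x\<close> sum to \<open>1\<close>;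
  it can be empty only on a null set of pairs \<open>(x, u)\<close>, where the value is irrelevant.\<close>

definition quantile_fn :: "nat \<Rightarrow> (nat \<Rightarrow> 'a \<Rightarrow> real) \<Rightarrow> 'a \<Rightarrow> real \<Rightarrow> nat" where
  "quantile_fn K Q x u = Min {k \<in> {1..K}. (\<Sum>j=1..k. Q j x) > u}"

definition psi :: "'w measure \<Rightarrow> nat \<Rightarrow> ('w \<Rightarrow> nat) \<Rightarrow> ('w \<Rightarrow> nat) \<Rightarrow> real" where
  "psi M K Y Y' =
     1 / (real K - 1) *
     (\<Sum>i=1..K. \<Sum>j=1..K.
        (\<P>(\<omega> in M. Y \<omega> = i \<and> Y' \<omega> = j) - \<P>(\<omega> in M. Y \<omega> = i) * \<P>(\<omega> in M. Y \<omega> = j))\<^sup>2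
        / (\<P>(\<omega> in M. Y \<omega> = i) * \<P>(\<omega> in M. Y \<omega> = j)))"

text \<open>Index of the nearest neighbour of \<open>x i\<close> among the other points of \<open>x 1, \<dots>, x n\<close>
  (meaningful for \<open>n \<ge> 2\<close>). Where the nearest neighbour is unique, \<open>LEAST\<close> picks it;
  possible ties are resolved in favour of the smallest index.\<close>

definition nn_index :: "(nat \<Rightarrow> 'a::metric_space) \<Rightarrow> nat \<Rightarrow> nat \<Rightarrow> nat" where
  "nn_index x n i =
     (LEAST j. j \<in> {1..n} - {i} \<and> (\<forall>l \<in> {1..n} - {i}. dist (x i) (x j) \<le> dist (x i) (x l)))"

definition p_hat ::
    "(nat \<Rightarrow> 'a::metric_space) \<Rightarrow> (nat \<Rightarrow> nat) \<Rightarrow> nat \<Rightarrow> nat \<Rightarrow> nat \<Rightarrow> real" where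
  "p_hat x y n k l =
     1 / real n * (\<Sum>i=1..n. of_bool (y i = k \<and> y (nn_index x n i) = l))"

definition p_hat_row ::
    "nat \<Rightarrow> (nat \<Rightarrow> 'a::metric_space) \<Rightarrow> (nat \<Rightarrow> nat) \<Rightarrow> nat \<Rightarrow> nat \<Rightarrow> real" where
  "p_hat_row K x y n k = (\<Sum>l=1..K. p_hat x y n k l)"

definition q_hat_col ::
    "nat \<Rightarrow> (nat \<Rightarrow> 'a::metric_space) \<Rightarrow> (nat \<Rightarrow> nat) \<Rightarrow> nat \<Rightarrow> nat \<Rightarrow> real" where
  "q_hat_col K x y n l = (\<Sum>k=1..K. p_hat x y n k l)"

text \<open>Summands with zero denominator vanish because of \<open>a / 0 = 0\<close>.\<close>

definition psi_hat ::
    "nat \<Rightarrow> (nat \<Rightarrow> 'a::metric_space) \<Rightarrow> (nat \<Rightarrow> nat) \<Rightarrow> nat \<Rightarrow> real" where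
  "psi_hat K x y n =
     1 / (real K - 1) *
     (\<Sum>k=1..K. \<Sum>l=1..K.
        (p_hat x y n k l - p_hat_row K x y n k * q_hat_col K x y n l)\<^sup>2
        / (p_hat_row K x y n k * q_hat_col K x y n l))"

end

theory Submission
  imports Defs
begin

text \<open>
  Put \<open>q k x = P (f x U = k)\<close>. Then \<open>p\<^sub>k\<^sub>,\<^sub>l = E [q k X * q l X]\<close>, and the indicator of
  \<open>Y\<^sub>i = k, Y\<^sub>N\<^sub>(\<^sub>i\<^sub>) = l\<close> minus \<open>p\<^sub>k\<^sub>,\<^sub>l\<close> splits into three parts. The residual after subtracting
  \<open>q k X\<^sub>i * q l X\<^sub>N\<^sub>(\<^sub>i\<^sub>)\<close> is centred given the covariates, and two residuals are conditionally
  uncorrelated unless \<open>{i, N(i)}\<close> meets \<open>{j, N(j)}\<close>; this is rare, because neighbour distances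
  tend to \<open>0\<close> while \<open>d(X\<^sub>1, X\<^sub>2)\<close> has no atom at \<open>0\<close>, so no bound on the number of points sharing a
  neighbour is needed. The bias \<open>q l X\<^sub>N\<^sub>(\<^sub>i\<^sub>) - q l X\<^sub>i\<close> tends to \<open>0\<close> in mean under either
  condition, uniformly in \<open>i\<close> by exchangeability. The average of \<open>q k X\<^sub>i * q l X\<^sub>i\<close> obeys the weak
  law of large numbers.
\<close>

section \<open>Nearest neighbours and convergence in probability\<close>

text \<open>The second moment of the averaged residual is a double sum over (i, j). The diagonal and
  the events N(i) = j and N(j) = i cost 3/n in all, because the probabilities of N(i) = j sum to 1
  over j. A shared neighbour forces X_i and X_j to within twice the larger of their neighbour
  distances, so its probability is at most P(d(X_1, X_2) \<le> d) + 2 P(d(X_1, X_N(1)) > d/2) for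
  every d > 0. With d fixed small and n growing, both terms become negligible. A version Q_k is
  determined only up to a P_X-null set, so the argument is run with \<open>q\<close>, which lies in
  [0, 1] at every point; the versions return only at the end, where they are shown to agree with
  \<open>q\<close> almost everywhere. The row and column sums of the limits are both the level
  probabilities. As these are positive, the coefficient is a continuous function near the limit
  point.\<close>

lemma nn_index_props:
  assumes "n \<ge> 2"
  shows "nn_index x n i \<in> {1..n} - {i}"
    and "l \<in> {1..n} - {i} \<Longrightarrow> dist (x i) (x (nn_index x n i)) \<le> dist (x i) (x l)"
proof -
  have "(if i = 1 then 2 else 1) \<in> {1..n} - {i}"
    using assms by auto
  then have "{1..n} - {i} \<noteq> {}" by blast
  then obtain j where "is_arg_min (\<lambda>l. dist (x i) (x l)) (\<lambda>l. l \<in> {1..n} - {i}) j"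
    using ex_is_arg_min_if_finite[of "{1..n} - {i}" "\<lambda>l. dist (x i) (x l)"] by auto
  then have "\<exists>j. j \<in> {1..n} - {i} \<and> (\<forall>l \<in> {1..n} - {i}. dist (x i) (x j) \<le> dist (x i) (x l))"
    unfolding is_arg_min_linorder by blast
  from LeastI_ex[OF this]
  have *: "nn_index x n i \<in> {1..n} - {i} \<and>
      (\<forall>l \<in> {1..n} - {i}. dist (x i) (x (nn_index x n i)) \<le> dist (x i) (x l))"
    unfolding nn_index_def .
  from * show "nn_index x n i \<in> {1..n} - {i}" by (rule conjunct1)
  from * show "l \<in> {1..n} - {i} \<Longrightarrow> dist (x i) (x (nn_index x n i)) \<le> dist (x i) (x l)" by (rule bspec[OF conjunct2])
qed

text \<open>The index reads only the points 1, ..., n, so a sequence and its restriction to {1..}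
  have the same neighbours.\<close>

lemma nn_index_cong:
  assumes "\<And>j. j \<in> {1..n} \<Longrightarrow> x j = y j" "i \<in> {1..n}"
  shows "nn_index x n i = nn_index y n i"
proof -
  have "(j \<in> {1..n} - {i} \<and> (\<forall>l \<in> {1..n} - {i}. dist (x i) (x j) \<le> dist (x i) (x l))) =
        (j \<in> {1..n} - {i} \<and> (\<forall>l \<in> {1..n} - {i}. dist (y i) (y j) \<le> dist (y i) (y l)))" for j
    using assms by auto
  then show ?thesis unfolding nn_index_def by (simp only:)
qed

text \<open>The cycle 1 -> i, 2 -> 1, ..., i -> i - 1 that fixes all later indices. It is increasing
  on {2..}, which the transposition of 1 and i is not when i > 2; the order matters because ties go
  to the smallest index.\<close>

definition move_front :: "nat \<Rightarrow> nat \<Rightarrow> nat" where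
  "move_front i j = (if j = 1 then i else if j \<le> i then j - 1 else j)"

lemma inj_move_front: "1 \<le> i \<Longrightarrow> inj_on (move_front i) {1..}"
  by (auto simp: inj_on_def move_front_def split: if_splits)

lemma move_front_1 [simp]: "move_front i 1 = i" "move_front i (Suc 0) = i"
  by (simp_all add: move_front_def)

lemma move_front_ge_1: "1 \<le> i \<Longrightarrow> 1 \<le> j \<Longrightarrow> 1 \<le> move_front i j"
  by (auto simp: move_front_def)

lemma move_front_image:
  assumes "i \<in> {1..n}"
  shows "move_front i ` ({1..n} - {1}) = {1..n} - {i}"
proof (intro equalityI subsetI)
  fix l assume l: "l \<in> {1..n} - {i}"
  show "l \<in> move_front i ` ({1..n} - {1})"
  proof (cases "l < i")
    case True
    then have "l = move_front i (Suc l)" "Suc l \<in> {1..n} - {1}"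
      using l assms by (auto simp: move_front_def)
    then show ?thesis by blast
  next
    case False
    then have "l = move_front i l" "l \<in> {1..n} - {1}"
      using l assms by (auto simp: move_front_def)
    then show ?thesis by blast
  qed
qed (use assms in \<open>auto simp: move_front_def split: if_splits\<close>)

text \<open>The renumbering preserves the order of the candidate neighbours, hence also the tie-breaking
  by the smallest index.\<close>

lemma nn_index_move_front:
  assumes "n \<ge> 2" "i \<in> {1..n}"
  shows "nn_index x n i = move_front i (nn_index (\<lambda>j. x (move_front i j)) n 1)"
proof -
  let ?p = "move_front i"
  let ?y = "\<lambda>j. x (?p j)"
  let ?P = "\<lambda>j. j \<in> {1..n} - {i} \<and> (\<forall>l \<in> {1..n} - {i}. dist (x i) (x j) \<le> dist (x i) (x l))"
  let ?R = "\<lambda>j. j \<in> {1..n} - {1} \<and> (\<forall>l \<in> {1..n} - {1}. dist (?y 1) (?y j) \<le> dist (?y 1) (?y l))"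
  note im = move_front_image[OF assms(2)]
  define m where "m = nn_index ?y n 1"
  have m: "?R m" using nn_index_props[OF assms(1), where x = ?y and i = 1] unfolding m_def by blast
  have "(LEAST j. ?P j) = ?p m"
  proof (rule Least_equality)
    show "?P (?p m)" unfolding im[symmetric]
    proof (intro conjI ballI)
      show "?p m \<in> ?p ` ({1..n} - {1})" using m by blast
      fix l assume "l \<in> ?p ` ({1..n} - {1})"
      then obtain k where "k \<in> {1..n} - {1}" "l = ?p k" by blast
      then show "dist (x i) (x (?p m)) \<le> dist (x i) (x l)"
        using m by (metis move_front_1(1))
    qed
    fix j assume j: "?P j"
    then obtain k where k: "k \<in> {1..n} - {1}" "j = ?p k" using im by blast
    have "?R k"
    proof (intro conjI ballI)
      fix l assume "l \<in> {1..n} - {1}"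
      then have "?p l \<in> {1..n} - {i}" using im by blast
      then show "dist (?y 1) (?y k) \<le> dist (?y 1) (?y l)" using j k(2) by (metis move_front_1(1))
    qed (rule k(1))
    then have "m \<le> k" unfolding m_def nn_index_def by (rule Least_le)
    then show "?p m \<le> j" using m k by (auto simp: move_front_def)
  qed
  then show ?thesis by (simp only: nn_index_def m_def)
qed

text \<open>Second countability makes the distance of two measurable maps measurable;
  \<open>LEAST\<close> over a countable type then stays measurable.\<close>

lemma measurable_nn_index:
  fixes x :: "'w \<Rightarrow> nat \<Rightarrow> 'a::{metric_space, second_countable_topology}"
  assumes x: "\<And>j. j \<in> {1..n} \<Longrightarrow> (\<lambda>\<omega>. x \<omega> j) \<in> borel_measurable M"
    and i: "i \<in> {1..n}"
  shows "(\<lambda>\<omega>. nn_index (x \<omega>) n i) \<in> measurable M (count_space UNIV)"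
  unfolding nn_index_def
proof (rule measurable_Least)
  fix j
  have [measurable]: "(\<lambda>\<omega>. x \<omega> i) \<in> borel_measurable M" using i by (rule x)
  show "Measurable.pred M (\<lambda>\<omega>. j \<in> {1..n} - {i} \<and>
    (\<forall>l\<in>{1..n} - {i}. dist (x \<omega> i) (x \<omega> j) \<le> dist (x \<omega> i) (x \<omega> l)))"
  proof (cases "j \<in> {1..n} - {i}")
    case True
    then have [measurable]: "(\<lambda>\<omega>. x \<omega> j) \<in> borel_measurable M" by (intro x) auto
    have "Measurable.pred M (\<lambda>\<omega>. \<forall>l\<in>{1..n} - {i}. dist (x \<omega> i) (x \<omega> j) \<le> dist (x \<omega> i) (x \<omega> l))"
    proof (rule pred_intros_finite)
      fix l assume "l \<in> {1..n} - {i}"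
      then have [measurable]: "(\<lambda>\<omega>. x \<omega> l) \<in> borel_measurable M" by (intro x) auto
      show "Measurable.pred M (\<lambda>\<omega>. dist (x \<omega> i) (x \<omega> j) \<le> dist (x \<omega> i) (x \<omega> l))"
        by measurable
    qed simp
    with True show ?thesis by simp
  next
    case False
    then have *: "(\<lambda>\<omega>. j \<in> {1..n} - {i} \<and>
      (\<forall>l\<in>{1..n} - {i}. dist (x \<omega> i) (x \<omega> j) \<le> dist (x \<omega> i) (x \<omega> l))) = (\<lambda>_. False)"
      by blast
    show ?thesis unfolding * by measurable
  qed
qed

text \<open>A random index with countably many values preserves measurability. The codomain is first
  cut down to {1..n}, where the family \<open>g\<close> is controlled; \<open>2 \<le> n\<close>
  keeps the index inside.\<close>

lemma measurable_at_nn_index: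
  fixes x :: "'w \<Rightarrow> nat \<Rightarrow> 'a::{metric_space, second_countable_topology}"
  assumes x: "\<And>j. j \<in> {1..n} \<Longrightarrow> (\<lambda>\<omega>. x \<omega> j) \<in> borel_measurable M"
    and i: "i \<in> {1..n}" "2 \<le> n"
    and g: "\<And>j. j \<in> {1..n} \<Longrightarrow> g j \<in> measurable M N"
  shows "(\<lambda>\<omega>. g (nn_index (x \<omega>) n i) \<omega>) \<in> measurable M N"
proof (rule measurable_compose_countable'[where I="{1..n}"])
  show "(\<lambda>\<omega>. nn_index (x \<omega>) n i) \<in> measurable M (count_space {1..n})"
  proof (rule measurableI)
    show "nn_index (x \<omega>) n i \<in> space (count_space {1..n})" for \<omega>
      using nn_index_props(1)[OF i(2), of "x \<omega>" i] by simp
    show "(\<lambda>\<omega>. nn_index (x \<omega>) n i) -` A \<inter> space M \<in> sets M" for A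
      by (rule measurable_sets[OF measurable_nn_index[OF x i(1)]]) auto
  qed
qed (use g in auto)

section \<open>Tools for convergence in probability\<close>

lemma tendsto_0_squeeze:
  fixes f g :: "'b \<Rightarrow> real"
  assumes "\<And>x. 0 \<le> f x" "eventually (\<lambda>x. f x \<le> g x) F" "(g \<longlongrightarrow> 0) F"
  shows "(f \<longlongrightarrow> 0) F"
  by (rule Lim_null_comparison[OF _ assms(3)]) (use assms(1,2) in simp)

text \<open>Continuous mapping at a constant limit, where convergence of each coordinate already
  gives joint convergence. Continuity at the single point (a, b) suffices, which suits quotients
  whose denominator vanishes elsewhere. The events are assumed measurable for the union bound, and
  only eventually so because neighbours make sense from n = 2 on.\<close>

lemma tendsto_in_prob_const_compose2:
  fixes Z :: "nat \<Rightarrow> 'w \<Rightarrow> 'b::metric_space" and W :: "nat \<Rightarrow> 'w \<Rightarrow> 'c::metric_space"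
    and g :: "'b \<times> 'c \<Rightarrow> 'd::metric_space"
  assumes "finite_measure M"
    and Z: "tendsto_in_prob M Z (\<lambda>_. a)" and W: "tendsto_in_prob M W (\<lambda>_. b)"
    and Zm: "\<And>e. eventually (\<lambda>n. {\<omega>\<in>space M. dist (Z n \<omega>) a > e} \<in> sets M) sequentially"
    and Wm: "\<And>e. eventually (\<lambda>n. {\<omega>\<in>space M. dist (W n \<omega>) b > e} \<in> sets M) sequentially"
    and g: "isCont g (a, b)"
  shows "tendsto_in_prob M (\<lambda>n \<omega>. g (Z n \<omega>, W n \<omega>)) (\<lambda>_. g (a, b))"
  unfolding tendsto_in_prob_def
proof (intro allI impI)
  interpret finite_measure M by fact
  fix e :: real assume "e > 0"
  then obtain d where d: "d > 0" "\<And>p. dist p (a, b) < d \<Longrightarrow> dist (g p) (g (a, b)) < e"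
    using g unfolding continuous_at_eps_delta by blast
  define P where "P n = measure M {\<omega>\<in>space M. dist (Z n \<omega>) a > d/3}
      + measure M {\<omega>\<in>space M. dist (W n \<omega>) b > d/3}" for n
  have "P \<longlonglongrightarrow> 0 + 0"
    unfolding P_def by (intro tendsto_add Z[unfolded tendsto_in_prob_def, rule_format]
        W[unfolded tendsto_in_prob_def, rule_format]) (use d(1) in auto)
  moreover have "eventually (\<lambda>n. measure M {\<omega>\<in>space M. dist (g (Z n \<omega>, W n \<omega>)) (g (a, b)) > e} \<le> P n) sequentially"
    using Zm[of "d/3"] Wm[of "d/3"]
  proof eventually_elim
    case (elim n)
    have "{\<omega>\<in>space M. dist (g (Z n \<omega>, W n \<omega>)) (g (a, b)) > e}
       \<subseteq> {\<omega>\<in>space M. dist (Z n \<omega>) a > d/3} \<union> {\<omega>\<in>space M. dist (W n \<omega>) b > d/3}"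
    proof (rule subsetI, rule ccontr)
      fix \<omega> assume \<omega>: "\<omega> \<in> {\<omega>\<in>space M. dist (g (Z n \<omega>, W n \<omega>)) (g (a, b)) > e}"
        "\<omega> \<notin> {\<omega>\<in>space M. dist (Z n \<omega>) a > d/3} \<union> {\<omega>\<in>space M. dist (W n \<omega>) b > d/3}"
      \<comment> \<open>Each coordinate is within d/3, so the pair is within 2d/3, strictly below
        d.\<close>
      have "dist (Z n \<omega>, W n \<omega>) (a, b) \<le> dist (Z n \<omega>) a + dist (W n \<omega>) b"
        unfolding dist_Pair_Pair by (rule sqrt_sum_squares_le_sum) auto
      also have "\<dots> < d" using \<omega> d(1) by (simp add: not_less)
      finally show False using d(2) \<omega> by fastforce
    qed
    then have "measure M {\<omega>\<in>space M. dist (g (Z n \<omega>, W n \<omega>)) (g (a, b)) > e} \<le>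
       measure M ({\<omega>\<in>space M. dist (Z n \<omega>) a > d/3} \<union> {\<omega>\<in>space M. dist (W n \<omega>) b > d/3})"
      by (intro finite_measure_mono sets.Un elim)
    also have "\<dots> \<le> P n" unfolding P_def by (intro measure_Un_le elim)
    finally show ?case .
  qed
  ultimately show "(\<lambda>n. measure M {\<omega>\<in>space M. dist (g (Z n \<omega>, W n \<omega>)) (g (a, b)) > e}) \<longlonglongrightarrow> 0"
    by - (rule tendsto_0_squeeze[where g = P], simp_all)
qed

lemma tendsto_in_prob_sum:
  fixes Z :: "'i \<Rightarrow> nat \<Rightarrow> 'w \<Rightarrow> real"
  assumes "finite_measure M" "finite I"
    and "\<And>i. i \<in> I \<Longrightarrow> tendsto_in_prob M (Z i) (\<lambda>_. a i)"
    and "\<And>i. i \<in> I \<Longrightarrow> eventually (\<lambda>n. Z i n \<in> borel_measurable M) sequentially"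
  shows "tendsto_in_prob M (\<lambda>n \<omega>. \<Sum>i\<in>I. Z i n \<omega>) (\<lambda>_. \<Sum>i\<in>I. a i)"
  using assms(2-4)
proof (induction I rule: finite_induct)
  case empty
  then show ?case by (simp add: tendsto_in_prob_def)
next
  case (insert i I)
  have "tendsto_in_prob M (\<lambda>n \<omega>. (\<lambda>p. fst p + snd p) (Z i n \<omega>, \<Sum>i\<in>I. Z i n \<omega>))
    (\<lambda>_. (\<lambda>p. fst p + snd p) (a i, \<Sum>i\<in>I. a i))"
  proof (rule tendsto_in_prob_const_compose2[OF assms(1)])
    have "eventually (\<lambda>n. \<forall>j\<in>I. Z j n \<in> borel_measurable M) sequentially"
      using insert by (intro eventually_ball_finite) auto
    then have "eventually (\<lambda>n. (\<lambda>\<omega>. \<Sum>i\<in>I. Z i n \<omega>) \<in> borel_measurable M) sequentially"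
      by eventually_elim (intro borel_measurable_sum, blast)
    then show "eventually (\<lambda>n. {\<omega>\<in>space M. dist (\<Sum>i\<in>I. Z i n \<omega>) (\<Sum>i\<in>I. a i) > e} \<in> sets M) sequentially" for e
    proof eventually_elim
      case (elim n)
      note [measurable] = elim
      show ?case by measurable
    qed
    have "eventually (\<lambda>n. Z i n \<in> borel_measurable M) sequentially" using insert by simp
    then show "eventually (\<lambda>n. {\<omega>\<in>space M. dist (Z i n \<omega>) (a i) > e} \<in> sets M) sequentially" for e
    proof eventually_elim
      case (elim n)
      note [measurable] = elim
      show ?case by measurable
    qed
  qed (use insert in \<open>auto intro!: continuous_intros\<close>)
  then show ?case using insert.hyps by simp
qed

lemma tendsto_in_prob_cong:
  assumes "eventually (\<lambda>n. \<forall>\<omega>\<in>space M. Z n \<omega> = W n \<omega>) sequentially"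
    and "\<And>\<omega>. \<omega> \<in> space M \<Longrightarrow> L \<omega> = L' \<omega>" and "tendsto_in_prob M Z L"
  shows "tendsto_in_prob M W L'"
  unfolding tendsto_in_prob_def
proof (intro allI impI)
  fix e :: real assume "e > 0"
  with assms(3) have "(\<lambda>n. measure M {\<omega>\<in>space M. dist (Z n \<omega>) (L \<omega>) > e}) \<longlonglongrightarrow> 0"
    by (simp add: tendsto_in_prob_def)
  moreover have "eventually (\<lambda>n. measure M {\<omega>\<in>space M. dist (Z n \<omega>) (L \<omega>) > e} =
      measure M {\<omega>\<in>space M. dist (W n \<omega>) (L' \<omega>) > e}) sequentially"
    using assms(1)
  proof eventually_elim
    case (elim n)
    then have "{\<omega>\<in>space M. dist (Z n \<omega>) (L \<omega>) > e} = {\<omega>\<in>space M. dist (W n \<omega>) (L' \<omega>) > e}"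
      using assms(2) by auto
    then show ?case by simp
  qed
  ultimately show "(\<lambda>n. measure M {\<omega>\<in>space M. dist (W n \<omega>) (L' \<omega>) > e}) \<longlonglongrightarrow> 0"
    by (rule Lim_transform_eventually)
qed

text \<open>Markov's inequality for the p-th absolute moment; p = 2 serves the variance arguments
  and p = 1 the bias.\<close>

lemma tendsto_in_prob_Lp:
  fixes Z :: "nat \<Rightarrow> 'w \<Rightarrow> real"
  assumes "prob_space M"
    and "eventually (\<lambda>n. integrable M (\<lambda>\<omega>. \<bar>Z n \<omega>\<bar> ^ p)) sequentially" and "p > 0"
    and "(\<lambda>n. \<integral>\<omega>. \<bar>Z n \<omega>\<bar> ^ p \<partial>M) \<longlonglongrightarrow> 0"
  shows "tendsto_in_prob M Z (\<lambda>_. 0)"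
  unfolding tendsto_in_prob_def
proof (intro allI impI)
  interpret prob_space M by fact
  fix e :: real assume e: "e > 0"
  have "measure M {\<omega>\<in>space M. dist (Z n \<omega>) 0 > e} \<le> (\<integral>\<omega>. \<bar>Z n \<omega>\<bar> ^ p \<partial>M) / e ^ p"
    if int: "integrable M (\<lambda>\<omega>. \<bar>Z n \<omega>\<bar> ^ p)" for n
  proof -
    have [measurable]: "(\<lambda>\<omega>. \<bar>Z n \<omega>\<bar> ^ p) \<in> borel_measurable M" using int by simp
    have "measure M {\<omega>\<in>space M. dist (Z n \<omega>) 0 > e} \<le> measure M {\<omega>\<in>space M. \<bar>Z n \<omega>\<bar> ^ p \<ge> e ^ p}"
    proof (rule finite_measure_mono)
      show "{\<omega>\<in>space M. dist (Z n \<omega>) 0 > e} \<subseteq> {\<omega>\<in>space M. \<bar>Z n \<omega>\<bar> ^ p \<ge> e ^ p}"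
        using e by (auto intro!: power_mono)
    qed measurable
    also have "\<dots> \<le> (\<integral>\<omega>. \<bar>Z n \<omega>\<bar> ^ p \<partial>M) / e ^ p"
      using e int by (intro integral_Markov_inequality_measure[where A="{}"]) auto
    finally show ?thesis .
  qed
  then have "eventually (\<lambda>n. measure M {\<omega>\<in>space M. dist (Z n \<omega>) 0 > e} \<le>
       (\<integral>\<omega>. \<bar>Z n \<omega>\<bar> ^ p \<partial>M) / e ^ p) sequentially"
    by (rule eventually_mono[OF assms(2)])
  moreover have "(\<lambda>n. (\<integral>\<omega>. \<bar>Z n \<omega>\<bar> ^ p \<partial>M) / e ^ p) \<longlonglongrightarrow> 0 / e ^ p"
    using e by (intro tendsto_divide assms tendsto_const) auto
  ultimately show "(\<lambda>n. measure M {\<omega>\<in>space M. dist (Z n \<omega>) 0 > e}) \<longlonglongrightarrow> 0"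
    by - (rule tendsto_0_squeeze[where g = "\<lambda>n. (\<integral>\<omega>. \<bar>Z n \<omega>\<bar> ^ p \<partial>M) / e ^ p"], simp_all)
qed

section \<open>Independence of the sample\<close>

lemma (in prob_space) integrable_bounded:
  fixes g :: "'a \<Rightarrow> real"
  assumes "g \<in> borel_measurable M" "\<And>x. \<bar>g x\<bar> \<le> B"
  shows "integrable M g"
  using assms by (intro integrable_const_bound[where B = B]) auto

lemma abs_mult_le_1: "\<bar>a\<bar> \<le> 1 \<Longrightarrow> \<bar>b\<bar> \<le> 1 \<Longrightarrow> \<bar>a * b\<bar> \<le> 1" for a b :: real
  by (simp add: abs_mult mult_le_one)

text \<open>The library's \<open>indep_var\<close> forces both variables to have the same type.\<close>

lemma (in prob_space) distr_Pair_eq: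
  assumes X [measurable]: "X \<in> measurable M S" and Y [measurable]: "Y \<in> measurable M T"
    and prod: "\<And>A B. A \<in> sets S \<Longrightarrow> B \<in> sets T \<Longrightarrow>
      prob {\<omega>\<in>space M. X \<omega> \<in> A \<and> Y \<omega> \<in> B} =
      prob {\<omega>\<in>space M. X \<omega> \<in> A} * prob {\<omega>\<in>space M. Y \<omega> \<in> B}"
  shows "distr M (S \<Otimes>\<^sub>M T) (\<lambda>\<omega>. (X \<omega>, Y \<omega>)) = distr M S X \<Otimes>\<^sub>M distr M T Y"
proof -
  interpret X: prob_space "distr M S X" by (rule prob_space_distr) fact
  interpret Y: prob_space "distr M T Y" by (rule prob_space_distr) fact
  show ?thesis
  proof (rule pair_measure_eqI[symmetric])
    fix A B assume A: "A \<in> sets (distr M S X)" and B: "B \<in> sets (distr M T Y)"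
    then have [measurable]: "A \<in> sets S" "B \<in> sets T" by simp_all
    have "emeasure (distr M (S \<Otimes>\<^sub>M T) (\<lambda>\<omega>. (X \<omega>, Y \<omega>))) (A \<times> B) =
        emeasure M {\<omega>\<in>space M. X \<omega> \<in> A \<and> Y \<omega> \<in> B}"
      by (subst emeasure_distr) (auto intro!: arg_cong[where f = "emeasure M"])
    also have "\<dots> = ennreal (prob {\<omega>\<in>space M. X \<omega> \<in> A} * prob {\<omega>\<in>space M. Y \<omega> \<in> B})"
      using prod[of A B] by (simp add: emeasure_eq_measure)
    also have "\<dots> = emeasure M {\<omega>\<in>space M. X \<omega> \<in> A} * emeasure M {\<omega>\<in>space M. Y \<omega> \<in> B}"
      by (simp add: emeasure_eq_measure ennreal_mult)
    also have "\<dots> = emeasure (distr M S X) A * emeasure (distr M T Y) B"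
      by (simp add: emeasure_distr vimage_def Int_def conj_commute)
    finally show "emeasure (distr M S X) A * emeasure (distr M T Y) B =
      emeasure (distr M (S \<Otimes>\<^sub>M T) (\<lambda>\<omega>. (X \<omega>, Y \<omega>))) (A \<times> B)" ..
  qed (simp_all add: X.sigma_finite_measure_axioms Y.sigma_finite_measure_axioms)
qed

text \<open>Here \<open>f\<close> and the noise law are arbitrary; the quantile function and the
  uniform law matter when \<open>q\<close> is recognised as the given conditional probabilities. The
  assumption \<open>small_distance\<close> says that d(X_1, X_2) puts little mass near 0, which is
  what its continuous distribution supplies.\<close>

locale nn_sample = prob_space M for M :: "'w measure" +
  fixes PX :: "'a::{metric_space, second_countable_topology} measure"
    and PU :: "real measure"
    and f :: "'a \<Rightarrow> real \<Rightarrow> nat"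
    and Xs :: "nat \<Rightarrow> 'w \<Rightarrow> 'a"
    and Us :: "nat \<Rightarrow> 'w \<Rightarrow> real"
  assumes prob_PX: "prob_space PX" and sets_PX: "sets PX = sets borel"
    and prob_PU: "prob_space PU" and sets_PU: "sets PU = sets borel"
    and f_measurable: "case_prod f \<in> measurable (borel \<Otimes>\<^sub>M borel) (count_space UNIV)"
    and indep: "indep_vars (\<lambda>_. borel \<Otimes>\<^sub>M borel) (\<lambda>i \<omega>. (Xs i \<omega>, Us i \<omega>)) {1..}"
    and law: "\<And>i. i \<ge> 1 \<Longrightarrow>
      distr M (borel \<Otimes>\<^sub>M borel) (\<lambda>\<omega>. (Xs i \<omega>, Us i \<omega>)) = PX \<Otimes>\<^sub>M PU"
    and small_distance:
      "\<And>e. e > 0 \<Longrightarrow> \<exists>d>0. prob {\<omega>\<in>space M. dist (Xs 1 \<omega>) (Xs 2 \<omega>) \<le> d} < e"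
begin

sublocale PX: prob_space PX by (rule prob_PX)
sublocale PU: prob_space PU by (rule prob_PU)
sublocale PXU: pair_prob_space PX PU ..

lemmas [measurable_cong] = sets_PX sets_PU

lemma space_PX [simp]: "space PX = UNIV"
  using sets_eq_imp_space_eq[OF sets_PX] by simp

lemma space_PU [simp]: "space PU = UNIV"
  using sets_eq_imp_space_eq[OF sets_PU] by simp

lemma f_measurable' [measurable (raw)]:
  assumes "g \<in> borel_measurable N" "h \<in> borel_measurable N"
  shows "(\<lambda>x. f (g x) (h x)) \<in> measurable N (count_space UNIV)"
  using measurable_compose[OF measurable_Pair[OF assms] f_measurable] by simp

lemma f_section [measurable]: "f x \<in> measurable borel (count_space UNIV)"
  using f_measurable'[of "\<lambda>_. x" borel "\<lambda>u. u"] by simp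

text \<open>The conditional probability of level k given x as an exact integral over the noise: it
  lies in [0, 1] at every x, whereas a version of the conditional probability is constrained only
  almost everywhere.\<close>

definition q :: "nat \<Rightarrow> 'a \<Rightarrow> real" where
  "q k x = (\<integral>u. of_bool (f x u = k) \<partial>PU)"

lemma q_measurable [measurable]: "q k \<in> borel_measurable borel"
  unfolding q_def by measurable

lemma q_nonneg: "0 \<le> q k x"
  unfolding q_def by (rule integral_nonneg_AE) simp

lemma q_le_1: "q k x \<le> 1"
proof -
  have "q k x \<le> (\<integral>u. 1 \<partial>PU)"
    unfolding q_def by (intro integral_mono PU.integrable_bounded[where B = 1]) (auto simp: of_bool_def)
  then show ?thesis using PU.prob_space by simp
qed

lemma abs_q_le_1: "\<bar>q k x\<bar> \<le> 1"
  using q_nonneg[of k x] q_le_1[of k x] by simp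

lemma XU_measurable: "i \<ge> 1 \<Longrightarrow> (\<lambda>\<omega>. (Xs i \<omega>, Us i \<omega>)) \<in> measurable M (borel \<Otimes>\<^sub>M borel)"
  using indep unfolding indep_vars_def by auto

lemma X_measurable: "i \<ge> 1 \<Longrightarrow> Xs i \<in> borel_measurable M"
  using measurable_compose[OF XU_measurable measurable_fst] by simp

lemma U_measurable: "i \<ge> 1 \<Longrightarrow> Us i \<in> borel_measurable M"
  using measurable_compose[OF XU_measurable measurable_snd] by simp

lemma X_law:
  assumes "i \<ge> 1"
  shows "distr M borel (Xs i) = PX"
proof -
  have "distr M borel (Xs i) = distr (distr M (borel \<Otimes>\<^sub>M borel) (\<lambda>\<omega>. (Xs i \<omega>, Us i \<omega>))) borel fst"
    using XU_measurable[OF assms] by (subst distr_distr) (auto simp: comp_def)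
  also have "\<dots> = distr (PX \<Otimes>\<^sub>M PU) PX fst"
    unfolding law[OF assms] by (rule distr_cong) (auto simp: sets_PX)
  finally show ?thesis by (simp add: PU.distr_pair_fst)
qed

lemma X_indep: "indep_vars (\<lambda>_. borel) Xs {1..}"
  using indep_vars_compose2[OF indep, of "\<lambda>_. fst" "\<lambda>_. borel"] by simp

text \<open>Given all covariates and all noise variables except \<open>Us i\<close>, the indicator
  of level k at i has conditional mean \<open>q k (Xs i)\<close>. Once centred, it is therefore
  orthogonal to every bounded function \<open>G\<close> of this information; \<open>G\<close> may
  read \<open>Xs i\<close> but not \<open>Us i\<close>. In place of conditional expectations the
  proof uses Fubini with the i-th noise variable innermost.\<close>

lemma expectation_centered_eq_0:
  fixes G :: "(nat \<Rightarrow> 'a) \<times> (nat \<Rightarrow> real) \<Rightarrow> real"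
  assumes i: "i \<ge> 1"
    and G [measurable]: "G \<in> borel_measurable (PiM {1..} (\<lambda>_. borel) \<Otimes>\<^sub>M PiM ({1..} - {i}) (\<lambda>_. borel))"
    and G1: "\<And>z. \<bar>G z\<bar> \<le> 1"
  shows "expectation (\<lambda>\<omega>. (of_bool (f (Xs i \<omega>) (Us i \<omega>) = k) - q k (Xs i \<omega>)) *
    G (\<lambda>j\<in>{1..}. Xs j \<omega>, \<lambda>j\<in>{1..} - {i}. Us j \<omega>)) = 0"
proof -
  define J where "J = {1..} - {i}"
  let ?B = "borel \<Otimes>\<^sub>M borel :: ('a \<times> real) measure"
  define XU where "XU j \<omega> = (Xs j \<omega>, Us j \<omega>)" for j \<omega>
  define R where "R \<omega> = (\<lambda>j\<in>J. XU j \<omega>)" for \<omega>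
  \<comment> \<open>Rebuilds the argument of \<open>G\<close> from the i-th pair and all the others.
    The noise component of the i-th pair is dropped, which makes \<open>G\<close> constant in the
    innermost integral.\<close>
  define merge where "merge z = (\<lambda>j\<in>{1..}. if j = i then fst (fst z) else fst (snd z j),
    \<lambda>j\<in>J. snd (snd z j))" for z :: "('a \<times> real) \<times> (nat \<Rightarrow> 'a \<times> real)"
  define h where "h z = (of_bool (f (fst (fst z)) (snd (fst z)) = k) - q k (fst (fst z))) * G (merge z)" for z
  define PR where "PR = distr M (PiM J (\<lambda>_. ?B)) R"
  have "indep_var (PiM {i} (\<lambda>_. ?B)) (\<lambda>\<omega>. restrict (\<lambda>i. XU i \<omega>) {i}) (PiM J (\<lambda>_. ?B)) (\<lambda>\<omega>. restrict (\<lambda>i. XU i \<omega>) J)"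
    unfolding XU_def by (rule indep_var_restrict[OF indep]) (use i in \<open>auto simp: J_def\<close>)
  note iv = this
  have Rm [measurable]: "R \<in> measurable M (PiM J (\<lambda>_. ?B))"
    using indep_var_rv2[OF iv] by (simp add: R_def[abs_def])
  have XUm [measurable]: "XU i \<in> measurable M ?B"
    unfolding XU_def by (rule XU_measurable[OF i])
  have PR: "prob_space PR" unfolding PR_def by (rule prob_space_distr) fact
  have sPR [measurable_cong]: "sets PR = sets (PiM J (\<lambda>_. ?B))" by (simp add: PR_def)
  interpret PR: prob_space PR by fact
  have "distr M ?B (XU i) = PX \<Otimes>\<^sub>M PU" using law[OF i] unfolding XU_def .
  moreover have "distr M (?B \<Otimes>\<^sub>M PiM J (\<lambda>_. ?B)) (\<lambda>\<omega>. (XU i \<omega>, R \<omega>)) = distr M ?B (XU i) \<Otimes>\<^sub>M PR"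
    unfolding PR_def
  proof (rule distr_Pair_eq[OF XUm Rm])
    fix A C assume A: "A \<in> sets ?B" and C: "C \<in> sets (PiM J (\<lambda>_. ?B))"
    \<comment> \<open>Block independence treats the i-th pair as a family indexed by {i};
      \<open>?A\<close> is the cylinder that corresponds to \<open>A\<close> there.\<close>
    let ?A = "(\<lambda>z. z i) -` A \<inter> space (PiM {i} (\<lambda>_. ?B))"
    have "?A \<in> sets (PiM {i} (\<lambda>_. ?B))"
      using A by measurable
    from indep_varD[OF iv this C]
    have "prob ((\<lambda>\<omega>. (restrict (\<lambda>i. XU i \<omega>) {i}, R \<omega>)) -` (?A \<times> C) \<inter> space M) =
      prob ((\<lambda>\<omega>. restrict (\<lambda>i. XU i \<omega>) {i}) -` ?A \<inter> space M) * prob (R -` C \<inter> space M)"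
      by (simp add: R_def[abs_def])
    moreover have "(\<lambda>\<omega>. (restrict (\<lambda>i. XU i \<omega>) {i}, R \<omega>)) -` (?A \<times> C) \<inter> space M =
        {\<omega>\<in>space M. XU i \<omega> \<in> A \<and> R \<omega> \<in> C}"
      "(\<lambda>\<omega>. restrict (\<lambda>i. XU i \<omega>) {i}) -` ?A \<inter> space M = {\<omega>\<in>space M. XU i \<omega> \<in> A}"
      "R -` C \<inter> space M = {\<omega>\<in>space M. R \<omega> \<in> C}"
      using sets.sets_into_space[OF C] by (auto simp: space_PiM space_pair_measure)
    ultimately show "prob {\<omega>\<in>space M. XU i \<omega> \<in> A \<and> R \<omega> \<in> C} =
        prob {\<omega>\<in>space M. XU i \<omega> \<in> A} * prob {\<omega>\<in>space M. R \<omega> \<in> C}" by simp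
  qed
  ultimately have joint: "distr M (?B \<Otimes>\<^sub>M PiM J (\<lambda>_. ?B)) (\<lambda>\<omega>. (XU i \<omega>, R \<omega>)) = (PX \<Otimes>\<^sub>M PU) \<Otimes>\<^sub>M PR"
    by simp
  interpret PP: pair_prob_space "PX \<Otimes>\<^sub>M PU" PR ..
  have snd_comp: "(\<lambda>z. snd z j) \<in> measurable (?B \<Otimes>\<^sub>M PiM J (\<lambda>_. ?B)) ?B" if "j \<in> J" for j
    using that by measurable
  have "merge \<in> measurable (?B \<Otimes>\<^sub>M PiM J (\<lambda>_. ?B)) (PiM {1..} (\<lambda>_. borel) \<Otimes>\<^sub>M PiM J (\<lambda>_. borel))"
    unfolding merge_def
  proof (intro measurable_Pair measurable_restrict)
    fix j :: nat assume j: "j \<in> {1..}"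
    show "(\<lambda>z. if j = i then fst (fst z) else fst (snd z j)) \<in> borel_measurable (?B \<Otimes>\<^sub>M PiM J (\<lambda>_. ?B))"
    proof (cases "j = i")
      case False
      then have "j \<in> J" using j by (simp add: J_def)
      from measurable_compose[OF snd_comp[OF this] measurable_fst] False show ?thesis by simp
    qed (simp)
  next
    fix j assume "j \<in> J"
    from measurable_compose[OF snd_comp[OF this] measurable_snd]
    show "(\<lambda>z. snd (snd z j)) \<in> borel_measurable (?B \<Otimes>\<^sub>M PiM J (\<lambda>_. ?B))" .
  qed
  from measurable_compose[OF this G[folded J_def]]
  have [measurable]: "(\<lambda>z. G (merge z)) \<in> borel_measurable (?B \<Otimes>\<^sub>M PiM J (\<lambda>_. ?B))" .
  have hm [measurable]: "h \<in> borel_measurable (?B \<Otimes>\<^sub>M PiM J (\<lambda>_. ?B))"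
    unfolding h_def by measurable
  have h1: "\<bar>h z\<bar> \<le> 1" for z
    unfolding h_def using q_nonneg[of k] q_le_1[of k]
    by (intro abs_mult_le_1 G1) (auto simp: of_bool_def)
  have "expectation (\<lambda>\<omega>. (of_bool (f (Xs i \<omega>) (Us i \<omega>) = k) - q k (Xs i \<omega>)) *
    G (\<lambda>j\<in>{1..}. Xs j \<omega>, \<lambda>j\<in>{1..} - {i}. Us j \<omega>)) = expectation (\<lambda>\<omega>. h (XU i \<omega>, R \<omega>))"
  proof (rule Bochner_Integration.integral_cong[OF refl])
    fix \<omega>
    have "(\<lambda>j\<in>{1..}. Xs j \<omega>, \<lambda>j\<in>{1..} - {i}. Us j \<omega>) = merge (XU i \<omega>, R \<omega>)"
      by (auto simp: merge_def XU_def R_def J_def restrict_def fun_eq_iff)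
    then show "(of_bool (f (Xs i \<omega>) (Us i \<omega>) = k) - q k (Xs i \<omega>)) *
      G (\<lambda>j\<in>{1..}. Xs j \<omega>, \<lambda>j\<in>{1..} - {i}. Us j \<omega>) = h (XU i \<omega>, R \<omega>)"
      by (simp add: h_def XU_def)
  qed
  also have "\<dots> = (\<integral>z. h z \<partial>((PX \<Otimes>\<^sub>M PU) \<Otimes>\<^sub>M PR))"
    unfolding joint[symmetric] by (subst integral_distr) simp_all
  also have "\<dots> = (\<integral>r. (\<integral>xu. h (xu, r) \<partial>(PX \<Otimes>\<^sub>M PU)) \<partial>PR)"
  proof -
    have "integrable ((PX \<Otimes>\<^sub>M PU) \<Otimes>\<^sub>M PR) (\<lambda>(xu, r). h (xu, r))"
      by (intro PP.integrable_bounded[where B = 1]) (use h1 in auto)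
    from PP.integral_snd[OF this] show ?thesis by simp
  qed
  also have "\<dots> = (\<integral>r. 0 \<partial>PR)"
  proof (rule Bochner_Integration.integral_cong[OF refl])
    fix r assume r: "r \<in> space PR"
    then have r': "r \<in> space (PiM J (\<lambda>_. ?B))" by (simp add: PR_def)
    have [measurable]: "(\<lambda>xu. h (xu, r)) \<in> borel_measurable ?B"
      by (rule measurable_compose[OF measurable_Pair2'[OF r'] hm])
    have "(\<integral>xu. h (xu, r) \<partial>(PX \<Otimes>\<^sub>M PU)) = (\<integral>x. (\<integral>u. h ((x, u), r) \<partial>PU) \<partial>PX)"
      by (subst PXU.integral_fst'[symmetric])
        (use h1 in \<open>auto intro!: PXU.integrable_bounded[where B = 1]\<close>)
    also have "\<dots> = (\<integral>x. 0 \<partial>PX)"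
    proof (rule Bochner_Integration.integral_cong[OF refl])
      fix x
      \<comment> \<open>The value 0 is only a representative of the noise: since u is ignored, the
        factor \<open>G\<close> can be taken out of the integral over u.\<close>
      have indep_u: "merge ((x, u), r) = merge ((x, 0), r)" for u
        by (simp add: merge_def fun_eq_iff restrict_def)
      have "h ((x, u), r) = (of_bool (f x u = k) - q k x) * G (merge ((x, 0), r))" for u
        unfolding h_def fst_conv snd_conv indep_u[of u] by (rule refl)
      then have "(\<integral>u. h ((x, u), r) \<partial>PU) = (\<integral>u. of_bool (f x u = k) - q k x \<partial>PU) * G (merge ((x, 0), r))"
        by simp
      also have "(\<integral>u. of_bool (f x u = k) - q k x \<partial>PU) = q k x - q k x"
        unfolding q_def
        by (subst Bochner_Integration.integral_diff)
          (auto intro!: PU.integrable_bounded[where B = 1] simp: PU.prob_space[simplified])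
      finally show "(\<integral>u. h ((x, u), r) \<partial>PU) = 0" by simp
    qed
    finally show "(\<integral>xu. h (xu, r) \<partial>(PX \<Otimes>\<^sub>M PU)) = 0" by simp
  qed
  finally show ?thesis by simp
qed

section \<open>Exchangeability of the covariates\<close>

lemma X_process_law:
  "distr M (PiM {1..} (\<lambda>_. borel)) (\<lambda>\<omega>. \<lambda>j\<in>{1..}. Xs j \<omega>) = PiM {1..} (\<lambda>_. PX)"
proof -
  have "distr M (PiM {1..} (\<lambda>_. borel)) (\<lambda>\<omega>. \<lambda>j\<in>{1..}. Xs j \<omega>) = PiM {1..} (\<lambda>j. distr M borel (Xs j))"
    using X_indep by (subst (asm) indep_vars_iff_distr_eq_PiM') (auto intro: X_measurable)
  also have "\<dots> = PiM {1..} (\<lambda>_. PX)" by (intro PiM_cong) (auto simp: X_law)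
  finally show ?thesis .
qed

text \<open>Any injective selection from an i.i.d. sequence has the law of the whole sequence. Thus
  a few indices can be prescribed and the rest sent out of the way.\<close>

lemma expectation_reindex:
  fixes T :: "(nat \<Rightarrow> 'a) \<Rightarrow> real"
  assumes p: "inj_on p {1..}" "p \<in> {1..} \<rightarrow> {1..}"
    and T [measurable]: "T \<in> borel_measurable (PiM {1..} (\<lambda>_. borel))"
  shows "expectation (\<lambda>\<omega>. T (\<lambda>j\<in>{1..}. Xs (p j) \<omega>)) = expectation (\<lambda>\<omega>. T (\<lambda>j\<in>{1..}. Xs j \<omega>))"
proof -
  let ?B = "PiM {1..} (\<lambda>_. borel) :: (nat \<Rightarrow> 'a) measure"
  let ?P = "PiM {1..} (\<lambda>_. PX)"
  have s [measurable_cong]: "sets ?P = sets ?B" by (intro sets_PiM_cong) (auto simp: sets_PX)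
  have X: "(\<lambda>\<omega>. \<lambda>j\<in>{1..}. Xs j \<omega>) \<in> measurable M ?B"
    by (intro measurable_restrict X_measurable) auto
  have t: "(\<lambda>z. \<lambda>j\<in>{1..}. z (p j)) \<in> measurable ?B ?B"
    using p by (intro measurable_restrict measurable_component_singleton) auto
  have "(\<lambda>j\<in>{1..}. Xs (p j) \<omega>) = (\<lambda>z. \<lambda>j\<in>{1..}. z (p j)) (\<lambda>j\<in>{1..}. Xs j \<omega>)" for \<omega>
    using p(2) by (auto simp: fun_eq_iff restrict_def)
  then have "expectation (\<lambda>\<omega>. T (\<lambda>j\<in>{1..}. Xs (p j) \<omega>)) =
      (\<integral>z. T (\<lambda>j\<in>{1..}. z (p j)) \<partial>distr M ?B (\<lambda>\<omega>. \<lambda>j\<in>{1..}. Xs j \<omega>))"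
    using X measurable_compose[OF t T] by (subst integral_distr) auto
  also have "\<dots> = (\<integral>z. T z \<partial>distr ?P ?P (\<lambda>z. \<lambda>j\<in>{1..}. z (p j)))"
    unfolding X_process_law using t T s by (subst integral_distr) (auto cong: measurable_cong_sets)
  also have "distr ?P ?P (\<lambda>z. \<lambda>j\<in>{1..}. z (p j)) = ?P"
    by (rule distr_PiM_reindex[OF prob_PX p])
  also have "(\<integral>z. T z \<partial>?P) = expectation (\<lambda>\<omega>. T (\<lambda>j\<in>{1..}. Xs j \<omega>))"
    unfolding X_process_law[symmetric] using X T by (subst integral_distr) auto
  finally show ?thesis .
qed

end

section \<open>Neighbour distances\<close>

lemma (in prob_space) prob_eq_expectation:
  assumes "{\<omega>\<in>space M. P \<omega>} \<in> sets M"
  shows "prob {\<omega>\<in>space M. P \<omega>} = expectation (\<lambda>\<omega>. of_bool (P \<omega>))"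
proof -
  define A where "A = {\<omega>\<in>space M. P \<omega>}"
  have A: "A \<inter> space M = A" "A \<in> sets M" using assms by (auto simp: A_def)
  have "expectation (\<lambda>\<omega>. of_bool (P \<omega>)) = expectation (indicator A :: _ \<Rightarrow> real)"
    by (rule Bochner_Integration.integral_cong) (auto simp: A_def indicator_def)
  then show ?thesis using A by (simp add: A_def[symmetric])
qed

context nn_sample begin

definition nn :: "nat \<Rightarrow> nat \<Rightarrow> 'w \<Rightarrow> nat" where
  "nn n i \<omega> = nn_index (\<lambda>j. Xs j \<omega>) n i"

definition Xn :: "nat \<Rightarrow> nat \<Rightarrow> 'w \<Rightarrow> 'a" where
  "Xn n i \<omega> = Xs (nn n i \<omega>) \<omega>"

lemma nn_in: "n \<ge> 2 \<Longrightarrow> nn n i \<omega> \<in> {1..n} - {i}"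
  unfolding nn_def by (rule nn_index_props(1))

lemma dist_Xn_le: "n \<ge> 2 \<Longrightarrow> l \<in> {1..n} - {i} \<Longrightarrow> dist (Xs i \<omega>) (Xn n i \<omega>) \<le> dist (Xs i \<omega>) (Xs l \<omega>)"
  unfolding nn_def Xn_def by (rule nn_index_props(2))

lemma nn_measurable: "i \<in> {1..n} \<Longrightarrow> nn n i \<in> measurable M (count_space UNIV)"
  unfolding nn_def[abs_def] by (rule measurable_nn_index) (auto intro: X_measurable)

lemma at_nn_measurable:
  assumes "i \<in> {1..n}" "n \<ge> 2" "\<And>j. j \<in> {1..n} \<Longrightarrow> g j \<in> measurable M N"
  shows "(\<lambda>\<omega>. g (nn n i \<omega>) \<omega>) \<in> measurable M N"
  unfolding nn_def by (rule measurable_at_nn_index) (use assms in \<open>auto intro: X_measurable\<close>)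

lemma Xn_measurable: "i \<in> {1..n} \<Longrightarrow> n \<ge> 2 \<Longrightarrow> Xn n i \<in> borel_measurable M"
  unfolding Xn_def[abs_def] by (rule at_nn_measurable) (auto intro: X_measurable)

text \<open>Renumbering by \<open>move_front i\<close> turns the i-th point and its neighbour into
  the first point and its neighbour, and the law of the covariate process is invariant. Estimates
  for the first point therefore hold with the same value at every i.\<close>

lemma expectation_neighbour:
  fixes T :: "'a \<Rightarrow> 'a \<Rightarrow> real"
  assumes T: "(\<lambda>z. T (fst z) (snd z)) \<in> borel_measurable (borel \<Otimes>\<^sub>M borel)"
    and n: "n \<ge> 2" and i: "i \<in> {1..n}"
  shows "expectation (\<lambda>\<omega>. T (Xs i \<omega>) (Xn n i \<omega>)) = expectation (\<lambda>\<omega>. T (Xs 1 \<omega>) (Xn n 1 \<omega>))"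
proof -
  define S where "S z = T (z 1) (z (nn_index z n 1))" for z :: "nat \<Rightarrow> 'a"
  have comp: "(\<lambda>z. z j) \<in> borel_measurable (PiM {1..} (\<lambda>_. borel))" if "j \<in> {1..n}" for j :: nat
    using that by (intro measurable_component_singleton) auto
  have "(\<lambda>z :: nat \<Rightarrow> 'a. (z 1, z (nn_index z n 1))) \<in> measurable (PiM {1..} (\<lambda>_. borel)) (borel \<Otimes>\<^sub>M borel)"
  proof (rule measurable_Pair)
    show "(\<lambda>z :: nat \<Rightarrow> 'a. z (nn_index z n 1)) \<in> borel_measurable (PiM {1..} (\<lambda>_. borel))"
      by (rule measurable_at_nn_index[where g = "\<lambda>j z. z j" and x = "\<lambda>z. z"]) (use n comp in auto)
  qed (use n comp in auto)
  from measurable_compose[OF this T] have S: "S \<in> borel_measurable (PiM {1..} (\<lambda>_. borel))"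
    by (simp add: S_def[abs_def])
  have *: "S (\<lambda>j\<in>{1..}. Xs (move_front l j) \<omega>) = T (Xs l \<omega>) (Xn n l \<omega>)" if l: "l \<in> {1..n}" for l \<omega>
  proof -
    let ?z = "\<lambda>j\<in>{1..}. Xs (move_front l j) \<omega>"
    define m where "m = nn_index (\<lambda>j. Xs (move_front l j) \<omega>) n 1"
    have "m \<in> {1..n}" unfolding m_def using nn_index_props(1)[OF n] by blast
    moreover have "nn_index ?z n 1 = m"
      unfolding m_def using n by (intro nn_index_cong) auto
    moreover have "nn n l \<omega> = move_front l m"
      unfolding nn_def m_def using n l by (rule nn_index_move_front)
    ultimately show ?thesis by (simp add: S_def Xn_def)
  qed
  have "expectation (\<lambda>\<omega>. S (\<lambda>j\<in>{1..}. Xs (move_front l j) \<omega>)) = expectation (\<lambda>\<omega>. S (\<lambda>j\<in>{1..}. Xs j \<omega>))"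
    if "l \<in> {1..n}" for l
    using that inj_move_front[of l] move_front_ge_1[of l]
    by (intro expectation_reindex S) auto
  from this[of i] this[of 1] *[of i] *[of 1] show ?thesis using i n by simp
qed

lemma prob_dist_eq:
  assumes "i \<ge> 1" "j \<ge> 1" "i \<noteq> j"
  shows "prob {\<omega>\<in>space M. dist (Xs i \<omega>) (Xs j \<omega>) \<le> d} = prob {\<omega>\<in>space M. dist (Xs 1 \<omega>) (Xs 2 \<omega>) \<le> d}"
proof -
  \<comment> \<open>Any injection of {1..} with 1 -> i and 2 -> j will do; for k > 2 the value
    \<open>k + i + j\<close> exceeds both i and j.\<close>
  define p where "p k = (if k = 1 then i else if k = 2 then j else k + i + j)" for k :: nat
  define T where "T z = (of_bool (dist (z 1) (z 2) \<le> d) :: real)" for z :: "nat \<Rightarrow> 'a"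
  have [measurable]: "Xs k \<in> borel_measurable M" if "k \<ge> 1" for k using that by (rule X_measurable)
  have T: "T \<in> borel_measurable (PiM {1..} (\<lambda>_. borel))"
    unfolding T_def[abs_def] by measurable
  have "expectation (\<lambda>\<omega>. T (\<lambda>j\<in>{1..}. Xs (p j) \<omega>)) = expectation (\<lambda>\<omega>. T (\<lambda>j\<in>{1..}. Xs j \<omega>))"
    by (intro expectation_reindex T) (use assms in \<open>auto simp: inj_on_def p_def\<close>)
  then have "expectation (\<lambda>\<omega>. of_bool (dist (Xs i \<omega>) (Xs j \<omega>) \<le> d) :: real) =
      expectation (\<lambda>\<omega>. of_bool (dist (Xs 1 \<omega>) (Xs 2 \<omega>) \<le> d))"
    by (simp add: T_def p_def)
  then show ?thesis using assms by (subst (1 2) prob_eq_expectation) auto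
qed

text \<open>For a basic open set b, almost surely, either P_X(b) = 0 and X_1 misses b, or P_X(b) > 0
  and some later X_j hits b. A countable basis gives this for all b at once. A basic set around X_1
  inside the ball of radius e then contains some X_j, and from n = j on the neighbour of X_1 is at
  least as close.\<close>

lemma AE_neighbour_tendsto: "AE \<omega> in M. (\<lambda>n. dist (Xs 1 \<omega>) (Xn n 1 \<omega>)) \<longlonglongrightarrow> 0"
proof -
  obtain B :: "'a set set" where B: "countable B" "topological_basis B"
    using ex_countable_basis by blast
  have meas [measurable]: "Xs k \<in> borel_measurable M" if "k \<ge> 1" for k using that by (rule X_measurable)
  have "AE \<omega> in M. Xs 1 \<omega> \<in> b \<longrightarrow> (\<exists>j\<ge>2. Xs j \<omega> \<in> b)" if "b \<in> B" for b
  proof -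
    have [measurable]: "b \<in> sets borel" using topological_basis_open[OF B(2) that] by simp
    define r where "r = measure PX b"
    have r: "prob (Xs j -` A \<inter> space M) = measure PX A" if "j \<ge> 1" "A \<in> sets borel" for j A
      using that meas by (subst X_law[OF that(1), symmetric], subst measure_distr) auto
    show ?thesis
    proof (cases "r = 0")
      case True
      then have "prob (Xs 1 -` b \<inter> space M) = 0" using r[of 1 b] by (simp add: r_def)
      moreover have "Xs 1 -` b \<inter> space M \<in> sets M" by measurable
      ultimately have "AE \<omega> in M. \<omega> \<notin> Xs 1 -` b \<inter> space M" by (simp add: prob_eq_0)
      with AE_space show ?thesis by eventually_elim auto
    next
      case False
      \<comment> \<open>The event that no point after the first falls into b; index 1 is left out
        because X_1 cannot be its own neighbour.\<close>
      define E where "E = {\<omega>\<in>space M. \<forall>j\<ge>2. Xs j \<omega> \<notin> b}"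
      have E: "E \<in> sets M" unfolding E_def
      proof (intro sets.sets_Collect_countable_All)
        fix j :: nat
        show "{\<omega> \<in> space M. 2 \<le> j \<longrightarrow> Xs j \<omega> \<notin> b} \<in> sets M"
          by (cases "2 \<le> j") auto
      qed
      \<comment> \<open>On \<open>E\<close> the m independent points X_2, ..., X_(m+1) all miss b.
        The case m = 0 is separate because an intersection over no indices need not be an
        event.\<close>
      have "prob E \<le> (1 - r) ^ m" for m
      proof (cases "m = 0")
        case False
        have "prob (\<Inter>j\<in>{2..m+1}. Xs j -` (- b) \<inter> space M) = (\<Prod>j\<in>{2..m+1}. prob (Xs j -` (- b) \<inter> space M))"
          using False by (intro indep_varsD[OF X_indep]) auto
        also have "\<dots> = (\<Prod>j\<in>{2..m+1}. measure PX (- b))"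
          by (intro prod.cong r) auto
        also have "measure PX (- b) = 1 - r"
          using PX.prob_compl[of b] by (simp add: r_def sets_PX Compl_eq_Diff_UNIV)
        finally have *: "prob (\<Inter>j\<in>{2..m+1}. Xs j -` (- b) \<inter> space M) = (1 - r) ^ m" by simp
        have "prob E \<le> prob (\<Inter>j\<in>{2..m+1}. Xs j -` (- b) \<inter> space M)"
        proof (rule finite_measure_mono)
          show "(\<Inter>j\<in>{2..m+1}. Xs j -` (- b) \<inter> space M) \<in> sets M"
            using False by (intro sets.finite_INT measurable_sets[OF meas]) auto
        qed (auto simp: E_def)
        then show ?thesis unfolding * .
      qed simp
      moreover have "(\<lambda>m. (1 - r) ^ m) \<longlonglongrightarrow> 0"
        using False PX.prob_le_1[of b] by (intro LIMSEQ_power_zero) (auto simp: r_def zero_less_measure_iff)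
      ultimately have "prob E \<le> 0" by (intro LIMSEQ_le_const) auto
      then have "prob E = 0" using measure_nonneg[of M E] by simp
      then have "AE \<omega> in M. \<omega> \<notin> E" using E by (simp add: prob_eq_0)
      with AE_space show ?thesis by eventually_elim (auto simp: E_def)
    qed
  qed
  then have "AE \<omega> in M. \<forall>b\<in>B. Xs 1 \<omega> \<in> b \<longrightarrow> (\<exists>j\<ge>2. Xs j \<omega> \<in> b)"
    by (intro AE_ball_countable'[OF _ B(1)])
  then show ?thesis
  proof eventually_elim
    fix \<omega> assume *: "\<forall>b\<in>B. Xs 1 \<omega> \<in> b \<longrightarrow> (\<exists>j\<ge>2. Xs j \<omega> \<in> b)"
    show "(\<lambda>n. dist (Xs 1 \<omega>) (Xn n 1 \<omega>)) \<longlonglongrightarrow> 0"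
    proof (rule LIMSEQ_I)
      fix e :: real assume "e > 0"
      then obtain b where b: "b \<in> B" "Xs 1 \<omega> \<in> b" "b \<subseteq> ball (Xs 1 \<omega>) e"
        using topological_basisE[OF B(2), of "ball (Xs 1 \<omega>) e" "Xs 1 \<omega>"] by auto
      with * obtain j where j: "j \<ge> 2" "Xs j \<omega> \<in> b" by blast
      have "norm (dist (Xs 1 \<omega>) (Xn n 1 \<omega>) - 0) < e" if "n \<ge> j" for n
      proof -
        have "dist (Xs 1 \<omega>) (Xn n 1 \<omega>) \<le> dist (Xs 1 \<omega>) (Xs j \<omega>)"
          using that j by (intro dist_Xn_le) auto
        also have "\<dots> < e" using j b by auto
        finally show ?thesis by simp
      qed
      then show "\<exists>N. \<forall>n\<ge>N. norm (dist (Xs 1 \<omega>) (Xn n 1 \<omega>) - 0) < e" by blast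
    qed
  qed
qed

lemma prob_neighbour_far_tendsto:
  assumes "e > 0"
  shows "(\<lambda>n. prob {\<omega>\<in>space M. dist (Xs 1 \<omega>) (Xn n 1 \<omega>) > e}) \<longlonglongrightarrow> 0"
\<comment> \<open>The shift by 2 leaves only sample sizes at which the neighbour exists, so that
  every term is measurable.\<close>
proof (rule LIMSEQ_offset[of _ 2])
  have [measurable]: "Xs 1 \<in> borel_measurable M" by (rule X_measurable) simp
  have [measurable]: "Xn (n + 2) 1 \<in> borel_measurable M" for n by (rule Xn_measurable) auto
  have ev: "{\<omega>\<in>space M. dist (Xs 1 \<omega>) (Xn (n + 2) 1 \<omega>) > e} \<in> sets M" for n
    by measurable
  have meas: "(\<lambda>\<omega>. of_bool (dist (Xs 1 \<omega>) (Xn (n + 2) 1 \<omega>) > e) :: real) \<in> borel_measurable M" for n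
    by measurable
  have "(\<lambda>n. expectation (\<lambda>\<omega>. of_bool (dist (Xs 1 \<omega>) (Xn (n + 2) 1 \<omega>) > e) :: real)) \<longlonglongrightarrow> expectation (\<lambda>_. 0)"
  proof (rule integral_dominated_convergence[where w = "\<lambda>_. 1"])
    show "AE \<omega> in M. (\<lambda>n. of_bool (dist (Xs 1 \<omega>) (Xn (n + 2) 1 \<omega>) > e) :: real) \<longlonglongrightarrow> 0"
      using AE_neighbour_tendsto
    proof eventually_elim
      fix \<omega> assume "(\<lambda>n. dist (Xs 1 \<omega>) (Xn n 1 \<omega>)) \<longlonglongrightarrow> 0"
      then have "(\<lambda>n. dist (Xs 1 \<omega>) (Xn (n + 2) 1 \<omega>)) \<longlonglongrightarrow> 0" by (rule LIMSEQ_ignore_initial_segment)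
      from order_tendstoD(2)[OF this assms]
      have "eventually (\<lambda>n. of_bool (dist (Xs 1 \<omega>) (Xn (n + 2) 1 \<omega>) > e) = (0::real)) sequentially"
        by eventually_elim auto
      then show "(\<lambda>n. of_bool (dist (Xs 1 \<omega>) (Xn (n + 2) 1 \<omega>) > e) :: real) \<longlonglongrightarrow> 0"
        by (rule tendsto_eventually)
    qed
  qed (use meas in \<open>auto simp: of_bool_def\<close>)
  then show "(\<lambda>n. prob {\<omega>\<in>space M. dist (Xs 1 \<omega>) (Xn (n + 2) 1 \<omega>) > e}) \<longlonglongrightarrow> 0"
    unfolding prob_eq_expectation[OF ev] by simp
qed

lemma prob_neighbour_far_eq:
  assumes n: "n \<ge> 2" and i: "i \<in> {1..n}"
  shows "prob {\<omega>\<in>space M. dist (Xs i \<omega>) (Xn n i \<omega>) > e} = prob {\<omega>\<in>space M. dist (Xs 1 \<omega>) (Xn n 1 \<omega>) > e}"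
proof -
  have "{\<omega>\<in>space M. dist (Xs l \<omega>) (Xn n l \<omega>) > e} \<in> sets M" if l: "l \<in> {1..n}" for l
  proof -
    have [measurable]: "Xs l \<in> borel_measurable M" "Xn n l \<in> borel_measurable M"
      using l n by (auto intro: X_measurable Xn_measurable)
    show ?thesis by measurable
  qed
  moreover have "expectation (\<lambda>\<omega>. of_bool (dist (Xs i \<omega>) (Xn n i \<omega>) > e) :: real) =
    expectation (\<lambda>\<omega>. of_bool (dist (Xs 1 \<omega>) (Xn n 1 \<omega>) > e))"
    by (rule expectation_neighbour[where T = "\<lambda>x y. of_bool (dist x y > e)"]) (measurable, use n i in auto)
  ultimately show ?thesis using n i by (subst (1 2) prob_eq_expectation) auto
qed

end

section \<open>Correlation of the residuals\<close>

context nn_sample begin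

text \<open>The index m is deterministic here, so the residual depends on two sample pairs only;
  \<open>nn_resid\<close> puts the random neighbour in its place.\<close>

definition resid :: "nat \<Rightarrow> nat \<Rightarrow> nat \<Rightarrow> nat \<Rightarrow> 'w \<Rightarrow> real" where
  "resid k l i m \<omega> = of_bool (f (Xs i \<omega>) (Us i \<omega>) = k \<and> f (Xs m \<omega>) (Us m \<omega>) = l)
     - q k (Xs i \<omega>) * q l (Xs m \<omega>)"

lemma abs_resid_le_1: "\<bar>resid k l i m \<omega>\<bar> \<le> 1"
proof -
  have "0 \<le> q k (Xs i \<omega>) * q l (Xs m \<omega>)" "q k (Xs i \<omega>) * q l (Xs m \<omega>) \<le> 1"
    using q_nonneg q_le_1 by (auto intro: mult_le_one)
  then show ?thesis by (auto simp: resid_def of_bool_def)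
qed

lemma f_sample_measurable:
  "i \<ge> 1 \<Longrightarrow> (\<lambda>\<omega>. f (Xs i \<omega>) (Us i \<omega>)) \<in> measurable M (count_space UNIV)"
  by (intro f_measurable' X_measurable U_measurable)

lemma resid_measurable:
  assumes "i \<ge> 1" "m \<ge> 1"
  shows "resid k l i m \<in> borel_measurable M"
proof -
  note [measurable] = X_measurable[OF assms(1)] X_measurable[OF assms(2)]
    f_sample_measurable[OF assms(1)] f_sample_measurable[OF assms(2)]
  show ?thesis unfolding resid_def[abs_def] by measurable
qed

lemma nn_index_restrict:
  assumes "i \<in> {1..n}"
  shows "nn_index (\<lambda>j\<in>{1..}. Xs j \<omega>) n i = nn n i \<omega>"
  unfolding nn_def by (rule nn_index_cong) (use assms in auto)

text \<open>Expand the residual of \<open>i\<close> as \<open>1\<^sub>A 1\<^sub>B - a b = (1\<^sub>A - a) 1\<^sub>B + a (1\<^sub>B - b)\<close>: each centred factor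
  depends on one \<open>U\<close> that occurs nowhere else in the product.\<close>

lemma expectation_resid_disjoint:
  assumes ij: "i \<in> {1..n}" "j \<in> {1..n}" and m: "m \<ge> 1" "m' \<ge> 1"
    and distinct: "i \<noteq> j" "i \<noteq> m" "i \<noteq> m'" "m \<noteq> j" "m \<noteq> m'"
  shows "expectation (\<lambda>\<omega>. of_bool (nn n i \<omega> = m \<and> nn n j \<omega> = m') * (resid k l i m \<omega> * resid k l j m' \<omega>)) = 0"
proof -
  let ?N = "\<lambda>i. PiM {1..} (\<lambda>_. borel) \<Otimes>\<^sub>M PiM ({1..} - {i}) (\<lambda>_. borel) :: ((nat \<Rightarrow> 'a) \<times> (nat \<Rightarrow> real)) measure"
  let ?X = "\<lambda>\<omega>. \<lambda>j\<in>{1..}. Xs j \<omega>"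
  let ?U = "\<lambda>i \<omega>. \<lambda>j\<in>{1..} - {i}. Us j \<omega>"
  let ?y = "\<lambda>i \<omega>. f (Xs i \<omega>) (Us i \<omega>)"
  \<comment> \<open>The event that i and j have neighbours m and m' is a function of the covariates
    alone, so it may multiply either centred factor.\<close>
  define I where "I w = (of_bool (nn_index (fst w) n i = m \<and> nn_index (fst w) n j = m') :: real)"
    for w :: "(nat \<Rightarrow> 'a) \<times> (nat \<Rightarrow> real)"
  define S where "S w = of_bool (f (fst w j) (snd w j) = k \<and> f (fst w m') (snd w m') = l)
      - q k (fst w j) * q l (fst w m')"
    for w :: "(nat \<Rightarrow> 'a) \<times> (nat \<Rightarrow> real)"
  \<comment> \<open>\<open>G1\<close> multiplies the centred indicator at i and must not read
    \<open>Us i\<close>: i differs from m, j and m'. \<open>G2\<close> multiplies the one at m and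
    must not read \<open>Us m\<close>: m differs from j and m', and point i enters there only
    through its covariate.\<close>
  define G1 where "G1 w = I w * (of_bool (f (fst w m) (snd w m) = l) * S w)" for w
  define G2 where "G2 w = I w * (q k (fst w i) * S w)" for w
  have fm: "(\<lambda>w. fst w a) \<in> borel_measurable (?N b)" if "a \<ge> 1" for a b
    by (rule measurable_compose[OF measurable_fst measurable_component_singleton]) (use that in simp)
  have sm: "(\<lambda>w. snd w a) \<in> borel_measurable (?N b)" if "a \<ge> 1" "a \<noteq> b" for a b
    by (rule measurable_compose[OF measurable_snd measurable_component_singleton]) (use that in simp)
  have nm: "(\<lambda>w. nn_index (fst w) n a) \<in> measurable (?N b) (count_space UNIV)" if "a \<in> {1..n}" for a b
    by (rule measurable_nn_index[where x = fst]) (use that fm in auto)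
  have Im [measurable]: "I \<in> borel_measurable (?N b)" for b
  proof -
    note [measurable] = nm[OF ij(1)] nm[OF ij(2)]
    show ?thesis unfolding I_def[abs_def] by measurable
  qed
  have pos: "i \<ge> 1" "j \<ge> 1" using ij by auto
  have Sm [measurable]: "S \<in> borel_measurable (?N b)" if "b \<noteq> j" "b \<noteq> m'" for b
  proof -
    note [measurable] = fm[OF pos(2)] fm[OF m(2)] sm[OF pos(2) that(1)[symmetric]] sm[OF m(2) that(2)[symmetric]]
    show ?thesis unfolding S_def[abs_def] by measurable
  qed
  have G1m: "G1 \<in> borel_measurable (?N i)"
  proof -
    note [measurable] = fm[OF m(1)] sm[OF m(1) distinct(2)[symmetric]] Sm[OF distinct(1) distinct(3)]
    show ?thesis unfolding G1_def[abs_def] by measurable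
  qed
  have G2m: "G2 \<in> borel_measurable (?N m)"
  proof -
    note [measurable] = fm[OF pos(1)] Sm[OF distinct(4,5)]
    show ?thesis unfolding G2_def[abs_def] by measurable
  qed
  have I1: "\<bar>I w\<bar> \<le> 1" for w by (simp add: I_def)
  have S1: "\<bar>S w\<bar> \<le> 1" for w
  proof -
    have "0 \<le> q k (fst w j) * q l (fst w m')" "q k (fst w j) * q l (fst w m') \<le> 1"
      using q_nonneg q_le_1 by (auto intro: mult_le_one)
    then show ?thesis by (auto simp: S_def of_bool_def)
  qed
  have G1b: "\<bar>G1 w\<bar> \<le> 1" for w
    unfolding G1_def by (intro abs_mult_le_1 I1 S1) simp
  have G2b: "\<bar>G2 w\<bar> \<le> 1" for w
    unfolding G2_def by (intro abs_mult_le_1 I1 S1 abs_q_le_1)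
  have XUm: "(\<lambda>\<omega>. (?X \<omega>, ?U b \<omega>)) \<in> measurable M (?N b)" for b
    by (intro measurable_Pair measurable_restrict X_measurable U_measurable) auto
  let ?c = "\<lambda>k i \<omega>. of_bool (?y i \<omega> = k) - q k (Xs i \<omega>)"
  have c1: "\<bar>?c k i \<omega>\<bar> \<le> 1" for k i \<omega>
    using q_nonneg[of k "Xs i \<omega>"] q_le_1[of k "Xs i \<omega>"] by (simp add: of_bool_def)
  have cm: "?c k a \<in> borel_measurable M" if "a \<ge> 1" for k a
  proof -
    note [measurable] = X_measurable[OF that] f_sample_measurable[OF that]
    show ?thesis by measurable
  qed
  have int: "integrable M (\<lambda>\<omega>. ?c k i \<omega> * G1 (?X \<omega>, ?U i \<omega>))"
    "integrable M (\<lambda>\<omega>. ?c l m \<omega> * G2 (?X \<omega>, ?U m \<omega>))"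
    by (intro integrable_bounded[where B = 1] abs_mult_le_1 c1 G1b G2b borel_measurable_times cm pos m
      measurable_compose[OF XUm G1m] measurable_compose[OF XUm G2m])+
  have "expectation (\<lambda>\<omega>. of_bool (nn n i \<omega> = m \<and> nn n j \<omega> = m') * (resid k l i m \<omega> * resid k l j m' \<omega>)) =
     expectation (\<lambda>\<omega>. ?c k i \<omega> * G1 (?X \<omega>, ?U i \<omega>) + ?c l m \<omega> * G2 (?X \<omega>, ?U m \<omega>))"
  proof (rule Bochner_Integration.integral_cong[OF refl])
    fix \<omega>
    have I: "I (?X \<omega>, u) = of_bool (nn n i \<omega> = m \<and> nn n j \<omega> = m')" for u
      unfolding I_def fst_conv nn_index_restrict[OF ij(1)] nn_index_restrict[OF ij(2)] ..
    have S: "S (?X \<omega>, ?U i \<omega>) = resid k l j m' \<omega>" "S (?X \<omega>, ?U m \<omega>) = resid k l j m' \<omega>"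
      using pos m distinct by (simp_all add: S_def resid_def)
    have "?c k i \<omega> * G1 (?X \<omega>, ?U i \<omega>) + ?c l m \<omega> * G2 (?X \<omega>, ?U m \<omega>) =
      of_bool (nn n i \<omega> = m \<and> nn n j \<omega> = m') *
      ((?c k i \<omega> * of_bool (?y m \<omega> = l) + ?c l m \<omega> * q k (Xs i \<omega>)) * resid k l j m' \<omega>)"
      unfolding G1_def G2_def I S using pos m distinct by (simp add: algebra_simps)
    also have "?c k i \<omega> * of_bool (?y m \<omega> = l) + ?c l m \<omega> * q k (Xs i \<omega>) = resid k l i m \<omega>"
      by (simp add: resid_def algebra_simps)
    finally show "of_bool (nn n i \<omega> = m \<and> nn n j \<omega> = m') * (resid k l i m \<omega> * resid k l j m' \<omega>) =
      ?c k i \<omega> * G1 (?X \<omega>, ?U i \<omega>) + ?c l m \<omega> * G2 (?X \<omega>, ?U m \<omega>)" by (rule sym)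
  qed
  also have "\<dots> = expectation (\<lambda>\<omega>. ?c k i \<omega> * G1 (?X \<omega>, ?U i \<omega>)) + expectation (\<lambda>\<omega>. ?c l m \<omega> * G2 (?X \<omega>, ?U m \<omega>))"
    using int by (rule Bochner_Integration.integral_add)
  also have "\<dots> = 0 + 0"
    by (intro arg_cong2[where f = "(+)"] expectation_centered_eq_0 pos m G1m G2m G1b G2b)
  finally show ?thesis by simp
qed

definition nn_resid :: "nat \<Rightarrow> nat \<Rightarrow> nat \<Rightarrow> nat \<Rightarrow> 'w \<Rightarrow> real" where
  "nn_resid k l n i \<omega> = resid k l i (nn n i \<omega>) \<omega>"

lemma nn_resid_measurable:
  "i \<in> {1..n} \<Longrightarrow> n \<ge> 2 \<Longrightarrow> nn_resid k l n i \<in> borel_measurable M"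
  unfolding nn_resid_def[abs_def] by (rule at_nn_measurable) (auto intro: resid_measurable)

lemma abs_nn_resid_le_1: "\<bar>nn_resid k l n i \<omega>\<bar> \<le> 1"
  unfolding nn_resid_def by (rule abs_resid_le_1)

lemma nn_events:
  assumes "i \<in> {1..n}" "j \<in> {1..n}"
  shows "{\<omega>\<in>space M. nn n i \<omega> = m} \<in> sets M" "{\<omega>\<in>space M. nn n i \<omega> = nn n j \<omega>} \<in> sets M"
proof -
  note [measurable] = nn_measurable[OF assms(1)] nn_measurable[OF assms(2)]
  have pred: "Measurable.pred M (\<lambda>\<omega>. nn n i \<omega> = m)" for m by measurable
  show "{\<omega>\<in>space M. nn n i \<omega> = m} \<in> sets M" using pred by simp
  have "Measurable.pred M (\<lambda>\<omega>. nn n i \<omega> = nn n j \<omega>)"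
    by (rule measurable_compose_countable[OF pred]) measurable
  then show "{\<omega>\<in>space M. nn n i \<omega> = nn n j \<omega>} \<in> sets M" by simp
qed

text \<open>The random neighbours are resolved into a sum over their possible values (m, m'). Values
  for which i, j, m, m' are distinct contribute 0; what is left is the event \<open>C\<close>, on
  which the product is bounded by 1. An upper bound is all that a second moment requires.\<close>

lemma expectation_nn_resid_le:
  assumes n: "n \<ge> 2" and ij: "i \<in> {1..n}" "j \<in> {1..n}" "i \<noteq> j"
  shows "expectation (\<lambda>\<omega>. nn_resid k l n i \<omega> * nn_resid k l n j \<omega>) \<le>
    prob {\<omega>\<in>space M. nn n i \<omega> = j} + prob {\<omega>\<in>space M. nn n j \<omega> = i} +
    prob {\<omega>\<in>space M. nn n i \<omega> = nn n j \<omega>}"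
proof -
  define S where "S = {(m, m') \<in> {1..n} \<times> {1..n}. m \<noteq> i \<and> m' \<noteq> i \<and> m \<noteq> j \<and> m' \<noteq> j \<and> m \<noteq> m'}"
  have finS: "finite S" unfolding S_def by (rule finite_subset[of _ "{1..n} \<times> {1..n}"]) auto
  define T where "T p \<omega> = of_bool (nn n i \<omega> = fst p \<and> nn n j \<omega> = snd p) *
    (resid k l i (fst p) \<omega> * resid k l j (snd p) \<omega>)" for p \<omega>
  define C where "C = {\<omega>\<in>space M. nn n i \<omega> = j} \<union> {\<omega>\<in>space M. nn n j \<omega> = i} \<union> {\<omega>\<in>space M. nn n i \<omega> = nn n j \<omega>}"
  have C [measurable]: "C \<in> sets M"
    unfolding C_def by (intro sets.Un nn_events ij(1,2) nn_events(1)[of _ n i])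
  note [measurable] = nn_resid_measurable[OF ij(1) n] nn_resid_measurable[OF ij(2) n]
  have split: "nn_resid k l n i \<omega> * nn_resid k l n j \<omega> =
      indicator C \<omega> * (nn_resid k l n i \<omega> * nn_resid k l n j \<omega>) + (\<Sum>p\<in>S. T p \<omega>)" if "\<omega> \<in> space M" for \<omega>
  proof -
    have "(\<Sum>p\<in>S. T p \<omega>) = (\<Sum>p\<in>S. if p = (nn n i \<omega>, nn n j \<omega>) then resid k l i (fst p) \<omega> * resid k l j (snd p) \<omega> else 0)"
      by (rule sum.cong) (auto simp: T_def)
    also have "\<dots> = (if (nn n i \<omega>, nn n j \<omega>) \<in> S then nn_resid k l n i \<omega> * nn_resid k l n j \<omega> else 0)"
      using finS by (simp add: nn_resid_def)
    \<comment> \<open>No point is its own neighbour and i differs from j, so the coincidences listed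
      in \<open>C\<close> are the only ones that can occur.\<close>
    also have "(nn n i \<omega>, nn n j \<omega>) \<in> S \<longleftrightarrow> \<omega> \<notin> C"
      using nn_in[OF n, of i \<omega>] nn_in[OF n, of j \<omega>] that by (auto simp: S_def C_def)
    finally show ?thesis by (auto simp: indicator_def)
  qed
  have T0: "expectation (T p) = 0" and Tint: "integrable M (T p)" if p: "p \<in> S" for p
  proof -
    show "expectation (T p) = 0"
      unfolding T_def[abs_def] by (rule expectation_resid_disjoint) (use p ij in \<open>auto simp: S_def\<close>)
    have b: "fst p \<ge> 1" "snd p \<ge> 1" "i \<ge> 1" "j \<ge> 1" using p ij by (auto simp: S_def)
    note [measurable] = nn_measurable[OF ij(1)] nn_measurable[OF ij(2)] resid_measurable[OF b(3) b(1)]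
      resid_measurable[OF b(4) b(2)]
    show "integrable M (T p)"
      unfolding T_def by (intro integrable_bounded[where B = 1] abs_mult_le_1 abs_resid_le_1) simp_all
  qed
  have "expectation (\<lambda>\<omega>. nn_resid k l n i \<omega> * nn_resid k l n j \<omega>) =
     expectation (\<lambda>\<omega>. indicator C \<omega> * (nn_resid k l n i \<omega> * nn_resid k l n j \<omega>) + (\<Sum>p\<in>S. T p \<omega>))"
    by (rule Bochner_Integration.integral_cong[OF refl split])
  also have "\<dots> = expectation (\<lambda>\<omega>. indicator C \<omega> * (nn_resid k l n i \<omega> * nn_resid k l n j \<omega>)) + (\<Sum>p\<in>S. expectation (T p))"
    by (subst Bochner_Integration.integral_add)
      (auto intro!: integrable_bounded[where B = 1] abs_mult_le_1 abs_nn_resid_le_1 Tint Bochner_Integration.integrable_sum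
        simp: Bochner_Integration.integral_sum[OF Tint])
  also have "(\<Sum>p\<in>S. expectation (T p)) = 0" using T0 by simp
  also have "expectation (\<lambda>\<omega>. indicator C \<omega> * (nn_resid k l n i \<omega> * nn_resid k l n j \<omega>)) + 0 \<le> expectation (indicator C)"
  proof -
    have "indicator C \<omega> * (nn_resid k l n i \<omega> * nn_resid k l n j \<omega>) \<le> indicator C \<omega>" for \<omega>
      using abs_mult_le_1[OF abs_nn_resid_le_1 abs_nn_resid_le_1, of k l n i \<omega> k l n j \<omega>]
      by (auto simp: indicator_def)
    then have "expectation (\<lambda>\<omega>. indicator C \<omega> * (nn_resid k l n i \<omega> * nn_resid k l n j \<omega>)) \<le> expectation (indicator C)"
      by (intro integral_mono integrable_bounded[where B = 1] abs_mult_le_1 abs_nn_resid_le_1)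
        (auto simp: indicator_def)
    then show ?thesis by simp
  qed
  also have "expectation (indicator C) = prob C" using C by simp
  also have "\<dots> \<le> prob {\<omega>\<in>space M. nn n i \<omega> = j} + prob {\<omega>\<in>space M. nn n j \<omega> = i} +
    prob {\<omega>\<in>space M. nn n i \<omega> = nn n j \<omega>}"
    unfolding C_def using nn_events[OF ij(1,2)] nn_events[OF ij(2,1)]
    by (intro order.trans[OF measure_Un_le] add_right_mono measure_Un_le) auto
  finally show ?thesis .
qed

end

section \<open>Consistency of the empirical pair probabilities\<close>

text \<open>Expanding the square leaves a double sum of mixed moments. Working with bounds
  \<open>e i j\<close> instead of exact values lets one estimate serve both the dependent residuals
  and the independent covariates.\<close>

lemma (in prob_space) expectation_average_square_le:
  fixes Z :: "nat \<Rightarrow> 'a \<Rightarrow> real"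
  assumes Z: "\<And>i. i \<in> {1..n} \<Longrightarrow> Z i \<in> borel_measurable M"
    and b: "\<And>i \<omega>. \<bar>Z i \<omega>\<bar> \<le> 1"
    and e: "\<And>i j. i \<in> {1..n} \<Longrightarrow> j \<in> {1..n} \<Longrightarrow> expectation (\<lambda>\<omega>. Z i \<omega> * Z j \<omega>) \<le> e i j"
  shows "expectation (\<lambda>\<omega>. \<bar>1 / real n * (\<Sum>i=1..n. Z i \<omega>)\<bar> ^ 2) \<le> (\<Sum>i=1..n. \<Sum>j=1..n. e i j) / (real n)\<^sup>2"
    and "integrable M (\<lambda>\<omega>. \<bar>1 / real n * (\<Sum>i=1..n. Z i \<omega>)\<bar> ^ 2)"
proof -
  have int: "integrable M (\<lambda>\<omega>. Z i \<omega> * Z j \<omega>)" if "i \<in> {1..n}" "j \<in> {1..n}" for i j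
    by (intro integrable_bounded[where B = 1] abs_mult_le_1 b borel_measurable_times Z that)
  have sq: "\<bar>1 / real n * (\<Sum>i=1..n. Z i \<omega>)\<bar> ^ 2 = (\<Sum>i=1..n. \<Sum>j=1..n. Z i \<omega> * Z j \<omega>) / (real n)\<^sup>2" for \<omega>
    by (simp only: power2_abs power_mult_distrib power_one_over)
      (simp add: power2_eq_square sum_product)
  show "integrable M (\<lambda>\<omega>. \<bar>1 / real n * (\<Sum>i=1..n. Z i \<omega>)\<bar> ^ 2)"
    unfolding sq by (intro integrable_divide Bochner_Integration.integrable_sum int)
  have "expectation (\<lambda>\<omega>. \<bar>1 / real n * (\<Sum>i=1..n. Z i \<omega>)\<bar> ^ 2) =
      (\<Sum>i=1..n. \<Sum>j=1..n. expectation (\<lambda>\<omega>. Z i \<omega> * Z j \<omega>)) / (real n)\<^sup>2"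
  proof -
    have "expectation (\<lambda>\<omega>. \<Sum>i=1..n. \<Sum>j=1..n. Z i \<omega> * Z j \<omega>) =
        (\<Sum>i=1..n. expectation (\<lambda>\<omega>. \<Sum>j=1..n. Z i \<omega> * Z j \<omega>))"
      by (intro Bochner_Integration.integral_sum Bochner_Integration.integrable_sum int)
    also have "\<dots> = (\<Sum>i=1..n. \<Sum>j=1..n. expectation (\<lambda>\<omega>. Z i \<omega> * Z j \<omega>))"
      by (intro sum.cong refl Bochner_Integration.integral_sum int)
    finally show ?thesis unfolding sq by simp
  qed
  also have "\<dots> \<le> (\<Sum>i=1..n. \<Sum>j=1..n. e i j) / (real n)\<^sup>2"
    by (intro divide_right_mono sum_mono e) auto
  finally show "expectation (\<lambda>\<omega>. \<bar>1 / real n * (\<Sum>i=1..n. Z i \<omega>)\<bar> ^ 2) \<le> (\<Sum>i=1..n. \<Sum>j=1..n. e i j) / (real n)\<^sup>2" .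
qed

context nn_sample begin

text \<open>The neighbour is exactly one of the n indices. Summing over j replaces any estimate of a
  single probability and makes these n^2 terms contribute only n to the double sum.\<close>

lemma sum_prob_nn_eq:
  assumes "n \<ge> 2" "i \<in> {1..n}"
  shows "(\<Sum>j=1..n. prob {\<omega>\<in>space M. nn n i \<omega> = j}) = 1"
proof -
  have "(\<Sum>j=1..n. prob {\<omega>\<in>space M. nn n i \<omega> = j}) = prob (\<Union>j\<in>{1..n}. {\<omega>\<in>space M. nn n i \<omega> = j})"
    by (rule finite_measure_finite_Union[symmetric])
      (use nn_events(1)[OF assms(2,2)] in \<open>auto simp: disjoint_family_on_def\<close>)
  also have "(\<Union>j\<in>{1..n}. {\<omega>\<in>space M. nn n i \<omega> = j}) = space M"
    using nn_in[OF assms(1), of i] by blast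
  finally show ?thesis by (simp add: prob_space)
qed

text \<open>By the triangle inequality, two points with a common neighbour are within d of each
  other unless one of them has its neighbour farther than d/2. By exchangeability the bound is the
  same for all i and j.\<close>

lemma prob_nn_eq_nn_le:
  assumes n: "n \<ge> 2" and ij: "i \<in> {1..n}" "j \<in> {1..n}" "i \<noteq> j"
  shows "prob {\<omega>\<in>space M. nn n i \<omega> = nn n j \<omega>} \<le>
    prob {\<omega>\<in>space M. dist (Xs 1 \<omega>) (Xs 2 \<omega>) \<le> d} + 2 * prob {\<omega>\<in>space M. dist (Xs 1 \<omega>) (Xn n 1 \<omega>) > d/2}"
proof -
  note [measurable] = Xn_measurable[OF ij(1) n] Xn_measurable[OF ij(2) n]
  have [measurable]: "Xs i \<in> borel_measurable M" "Xs j \<in> borel_measurable M"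
    using ij by (auto intro: X_measurable)
  let ?A = "{\<omega>\<in>space M. dist (Xs i \<omega>) (Xs j \<omega>) \<le> d}"
  let ?F = "\<lambda>i. {\<omega>\<in>space M. dist (Xs i \<omega>) (Xn n i \<omega>) > d/2}"
  have "{\<omega>\<in>space M. nn n i \<omega> = nn n j \<omega>} \<subseteq> ?A \<union> (?F i \<union> ?F j)"
  proof (rule subsetI, rule ccontr)
    fix \<omega> assume \<omega>: "\<omega> \<in> {\<omega>\<in>space M. nn n i \<omega> = nn n j \<omega>}" "\<omega> \<notin> ?A \<union> (?F i \<union> ?F j)"
    then have "Xn n i \<omega> = Xn n j \<omega>" by (simp add: Xn_def)
    then have "dist (Xs i \<omega>) (Xs j \<omega>) \<le> dist (Xs i \<omega>) (Xn n i \<omega>) + dist (Xs j \<omega>) (Xn n j \<omega>)"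
      by (metis dist_triangle dist_commute)
    with \<omega> show False by auto
  qed
  then have "prob {\<omega>\<in>space M. nn n i \<omega> = nn n j \<omega>} \<le> prob (?A \<union> (?F i \<union> ?F j))"
    by (intro finite_measure_mono) auto
  also have "\<dots> \<le> prob ?A + (prob (?F i) + prob (?F j))"
    by (intro order.trans[OF measure_Un_le] add_left_mono measure_Un_le) auto
  also have "prob ?A = prob {\<omega>\<in>space M. dist (Xs 1 \<omega>) (Xs 2 \<omega>) \<le> d}"
    using ij by (intro prob_dist_eq) auto
  also have "prob (?F i) = prob (?F 1)" using prob_neighbour_far_eq[OF n ij(1)] .
  also have "prob (?F j) = prob (?F 1)" using prob_neighbour_far_eq[OF n ij(2)] .
  finally show ?thesis by simp
qed

text \<open>The bound on the second moment \<open>V n\<close> holds for every d, and d is chosen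
  before n: \<open>r d\<close> is made small, and then \<open>s d n\<close> and 3/n vanish as n
  grows with this d kept fixed.\<close>

lemma nn_resid_average_tendsto:
  "tendsto_in_prob M (\<lambda>n \<omega>. 1 / real n * (\<Sum>i=1..n. nn_resid k l n i \<omega>)) (\<lambda>_. 0)"
proof (rule tendsto_in_prob_Lp[where p = 2])
  define r where "r d = prob {\<omega>\<in>space M. dist (Xs 1 \<omega>) (Xs 2 \<omega>) \<le> d}" for d
  define s where "s d n = prob {\<omega>\<in>space M. dist (Xs 1 \<omega>) (Xn n 1 \<omega>) > d/2}" for d n
  define V where "V n = expectation (\<lambda>\<omega>. \<bar>1 / real n * (\<Sum>i=1..n. nn_resid k l n i \<omega>)\<bar> ^ 2)" for n
  have V: "V n \<le> 3 / real n + (r d + 2 * s d n)"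
    "integrable M (\<lambda>\<omega>. \<bar>1 / real n * (\<Sum>i=1..n. nn_resid k l n i \<omega>)\<bar> ^ 2)" if n: "n \<ge> 2" for n d
  proof -
    define P where "P i j = prob {\<omega>\<in>space M. nn n i \<omega> = j}" for i j
    define e where "e i j = of_bool (i = j) + (P i j + P j i + (r d + 2 * s d n))" for i j
    have P_nonneg: "0 \<le> P i j" for i j by (simp add: P_def)
    have rs_nonneg: "0 \<le> r d" "0 \<le> s d n" by (simp_all add: r_def s_def)
    have le: "expectation (\<lambda>\<omega>. nn_resid k l n i \<omega> * nn_resid k l n j \<omega>) \<le> e i j"
      if ij: "i \<in> {1..n}" "j \<in> {1..n}" for i j
    proof (cases "i = j")
      case True
      have "expectation (\<lambda>\<omega>. nn_resid k l n i \<omega> * nn_resid k l n j \<omega>) \<le> expectation (\<lambda>_. 1)"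
        using abs_mult_le_1[OF abs_nn_resid_le_1 abs_nn_resid_le_1]
        by (intro integral_mono integrable_bounded[where B = 1] borel_measurable_times nn_resid_measurable ij n)
          (auto simp: abs_le_iff)
      also have "\<dots> \<le> e i j" using True P_nonneg[of i j] P_nonneg[of j i] rs_nonneg by (simp add: e_def prob_space)
      finally show ?thesis .
    next
      case False
      from expectation_nn_resid_le[OF n ij False, of k l] prob_nn_eq_nn_le[OF n ij False, of d]
      show ?thesis using False by (simp add: e_def P_def r_def s_def)
    qed
    note sm = expectation_average_square_le[where Z = "nn_resid k l n" and n = n and e = e,
        OF nn_resid_measurable[OF _ n] abs_nn_resid_le_1 le]
    show "integrable M (\<lambda>\<omega>. \<bar>1 / real n * (\<Sum>i=1..n. nn_resid k l n i \<omega>)\<bar> ^ 2)"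
      by (rule sm(2))
    have P1: "(\<Sum>i=1..n. \<Sum>j=1..n. P i j) = n"
    proof -
      have "(\<Sum>i=1..n. \<Sum>j=1..n. P i j) = (\<Sum>i=1..n. 1)"
        unfolding P_def by (intro sum.cong refl sum_prob_nn_eq n)
      then show ?thesis by simp
    qed
    have P2: "(\<Sum>i=1..n. \<Sum>j=1..n. P j i) = n"
      using P1 by (subst sum.swap)
    have P3: "(\<Sum>i=1..n. \<Sum>j=1..n. of_bool (i = j)) = real n"
      by simp
    \<comment> \<open>The diagonal, \<open>P i j\<close> and \<open>P j i\<close> each sum to n,
      whence the 3; the bound for a shared neighbour occurs n^2 times and survives the division by
      n^2.\<close>
    have "(\<Sum>i=1..n. \<Sum>j=1..n. e i j) = 3 * real n + (real n)\<^sup>2 * (r d + 2 * s d n)"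
      unfolding e_def sum.distrib P1 P2 P3 by (simp add: power2_eq_square algebra_simps)
    also have "\<dots> / (real n)\<^sup>2 = 3 / real n + (r d + 2 * s d n)"
      using n by (simp add: add_divide_distrib power2_eq_square)
    finally show "V n \<le> 3 / real n + (r d + 2 * s d n)"
      unfolding V_def using sm(1) by simp
  qed
  show "eventually (\<lambda>n. integrable M (\<lambda>\<omega>. \<bar>1 / real n * (\<Sum>i=1..n. nn_resid k l n i \<omega>)\<bar> ^ 2)) sequentially"
    using eventually_ge_at_top[of 2] by eventually_elim (rule V(2))
  have "V \<longlonglongrightarrow> 0"
  proof (rule tendstoI)
    fix e :: real assume "e > 0"
    then obtain d where d: "d > 0" "r d < e / 2"
      using small_distance[of "e / 2"] by (auto simp: r_def)
    have "(\<lambda>n. 3 / real n + (r d + 2 * s d n)) \<longlonglongrightarrow> 0 + (r d + 2 * 0)"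
      unfolding s_def using d(1)
      by (intro tendsto_intros prob_neighbour_far_tendsto lim_const_over_n) auto
    from order_tendstoD(2)[OF this, of e] have "eventually (\<lambda>n. 3 / real n + (r d + 2 * s d n) < e) sequentially"
      using d(2) \<open>e > 0\<close> by simp
    then show "eventually (\<lambda>n. dist (V n) 0 < e) sequentially"
      using eventually_ge_at_top[of 2]
    proof eventually_elim
      case (elim n)
      have "0 \<le> V n" by (simp add: V_def)
      then show ?case using V(1)[OF elim(2), of d] elim(1) by simp
    qed
  qed
  then show "(\<lambda>n. expectation (\<lambda>\<omega>. \<bar>1 / real n * (\<Sum>i=1..n. nn_resid k l n i \<omega>)\<bar> ^ 2)) \<longlonglongrightarrow> 0"
    by (simp only: V_def[abs_def])
qed (auto intro: prob_space_axioms)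

text \<open>The common consequence of conditions (a) and (b) on which the bias estimate rests. By
  exchangeability the first point stands for all.\<close>

definition nn_regular :: "nat \<Rightarrow> bool" where
  "nn_regular l \<longleftrightarrow> (\<lambda>n. expectation (\<lambda>\<omega>. \<bar>q l (Xn n 1 \<omega>) - q l (Xs 1 \<omega>)\<bar>)) \<longlonglongrightarrow> 0"

text \<open>The mean absolute value is enough: the factor \<open>q k\<close> is at most 1, and the
  differences that remain have the same expected absolute value for every i, so their average equals
  the term for i = 1.\<close>

lemma bias_average_tendsto:
  assumes "nn_regular l"
  shows "tendsto_in_prob M (\<lambda>n \<omega>. 1 / real n * (\<Sum>i=1..n. q k (Xs i \<omega>) * (q l (Xn n i \<omega>) - q l (Xs i \<omega>)))) (\<lambda>_. 0)"
proof (rule tendsto_in_prob_Lp[where p = 1])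
  have b: "\<bar>q k x * (q l y - q l z)\<bar> \<le> \<bar>q l y - q l z\<bar>" "\<bar>q l y - q l z\<bar> \<le> 1" for x y z
    using q_nonneg[of l y] q_le_1[of l y] q_nonneg[of l z] q_le_1[of l z] abs_q_le_1[of k x]
    by (auto simp: abs_mult mult_left_le_one_le)
  let ?Z = "\<lambda>n \<omega>. \<bar>1 / real n * (\<Sum>i=1..n. q k (Xs i \<omega>) * (q l (Xn n i \<omega>) - q l (Xs i \<omega>)))\<bar>"
  have Zle: "?Z n \<omega> \<le> (\<Sum>i=1..n. \<bar>q l (Xn n i \<omega>) - q l (Xs i \<omega>)\<bar>) / real n" for n \<omega>
  proof -
    have "\<bar>\<Sum>i=1..n. q k (Xs i \<omega>) * (q l (Xn n i \<omega>) - q l (Xs i \<omega>))\<bar> \<le> (\<Sum>i=1..n. \<bar>q l (Xn n i \<omega>) - q l (Xs i \<omega>)\<bar>)"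
      by (intro order.trans[OF sum_abs] sum_mono b)
    then show ?thesis by (simp add: abs_mult divide_right_mono)
  qed
  have Z: "integrable M (?Z n)" "expectation (?Z n) \<le> expectation (\<lambda>\<omega>. \<bar>q l (Xn n 1 \<omega>) - q l (Xs 1 \<omega>)\<bar>)"
    if n: "n \<ge> 2" for n
  proof -
    have m [measurable]: "Xs i \<in> borel_measurable M" "Xn n i \<in> borel_measurable M" if "i \<in> {1..n}" for i
      using that n by (auto intro: X_measurable Xn_measurable)
    have int: "integrable M (\<lambda>\<omega>. \<bar>q l (Xn n i \<omega>) - q l (Xs i \<omega>)\<bar>)"
      "integrable M (\<lambda>\<omega>. q k (Xs i \<omega>) * (q l (Xn n i \<omega>) - q l (Xs i \<omega>)))" if i: "i \<in> {1..n}" for i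
    proof -
      note [measurable] = m[OF i]
      show "integrable M (\<lambda>\<omega>. \<bar>q l (Xn n i \<omega>) - q l (Xs i \<omega>)\<bar>)"
        by (intro integrable_bounded[where B = 1]) (measurable, simp add: b(2))
      show "integrable M (\<lambda>\<omega>. q k (Xs i \<omega>) * (q l (Xn n i \<omega>) - q l (Xs i \<omega>)))"
        by (intro integrable_bounded[where B = 1]) (measurable, rule order.trans[OF b])
    qed
    show "integrable M (?Z n)"
      by (intro integrable_abs integrable_mult_right Bochner_Integration.integrable_sum int)
    then have "expectation (?Z n) \<le> expectation (\<lambda>\<omega>. (\<Sum>i=1..n. \<bar>q l (Xn n i \<omega>) - q l (Xs i \<omega>)\<bar>) / real n)"
      by (intro integral_mono Zle integrable_divide Bochner_Integration.integrable_sum int)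
    also have "\<dots> = (\<Sum>i=1..n. expectation (\<lambda>\<omega>. \<bar>q l (Xn n i \<omega>) - q l (Xs i \<omega>)\<bar>)) / real n"
      by (simp add: Bochner_Integration.integral_sum int)
    also have "\<dots> = (\<Sum>i=1..n. expectation (\<lambda>\<omega>. \<bar>q l (Xn n 1 \<omega>) - q l (Xs 1 \<omega>)\<bar>)) / real n"
      by (intro arg_cong2[where f = "(/)"] sum.cong refl
        expectation_neighbour[where T = "\<lambda>x y. \<bar>q l y - q l x\<bar>"] n) measurable
    also have "\<dots> = expectation (\<lambda>\<omega>. \<bar>q l (Xn n 1 \<omega>) - q l (Xs 1 \<omega>)\<bar>)"
      using n by simp
    finally show "expectation (?Z n) \<le> expectation (\<lambda>\<omega>. \<bar>q l (Xn n 1 \<omega>) - q l (Xs 1 \<omega>)\<bar>)" .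
  qed
  show "eventually (\<lambda>n. integrable M (\<lambda>\<omega>. ?Z n \<omega> ^ 1)) sequentially"
    using eventually_ge_at_top[of 2] by eventually_elim (use Z(1) in simp)
  show "(\<lambda>n. expectation (\<lambda>\<omega>. ?Z n \<omega> ^ 1)) \<longlonglongrightarrow> 0"
  proof (rule tendsto_0_squeeze)
    show "eventually (\<lambda>n. expectation (\<lambda>\<omega>. ?Z n \<omega> ^ 1) \<le> expectation (\<lambda>\<omega>. \<bar>q l (Xn n 1 \<omega>) - q l (Xs 1 \<omega>)\<bar>)) sequentially"
      using eventually_ge_at_top[of 2] by eventually_elim (use Z(2) in simp)
  qed (use assms in \<open>simp_all add: nn_regular_def\<close>)
qed (auto intro: prob_space_axioms)

section \<open>Law of large numbers for functions of the covariates\<close>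

lemma expectation_X:
  fixes w :: "'a \<Rightarrow> real"
  assumes "w \<in> borel_measurable borel" "i \<ge> 1"
  shows "expectation (\<lambda>\<omega>. w (Xs i \<omega>)) = (\<integral>x. w x \<partial>PX)"
  unfolding X_law[OF assms(2), symmetric] using assms X_measurable by (subst integral_distr) auto

text \<open>Independence and centring remove the off-diagonal mixed moments, and the diagonal leaves
  a second moment of at most 1/n.\<close>

lemma X_average_tendsto:
  fixes w :: "'a \<Rightarrow> real"
  assumes w [measurable]: "w \<in> borel_measurable borel" and b: "\<And>x. \<bar>w x\<bar> \<le> 1"
    and mean: "(\<integral>x. w x \<partial>PX) = 0"
  shows "tendsto_in_prob M (\<lambda>n \<omega>. 1 / real n * (\<Sum>i=1..n. w (Xs i \<omega>))) (\<lambda>_. 0)"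
proof (rule tendsto_in_prob_Lp[where p = 2])
  have m: "(\<lambda>\<omega>. w (Xs i \<omega>)) \<in> borel_measurable M" if "i \<in> {1..n}" for i n
    using that by (intro measurable_compose[OF X_measurable w]) auto
  have le: "expectation (\<lambda>\<omega>. w (Xs i \<omega>) * w (Xs j \<omega>)) \<le> of_bool (i = j)" if ij: "i \<in> {1..n}" "j \<in> {1..n}" for i j n
  proof (cases "i = j")
    case True
    have "expectation (\<lambda>\<omega>. w (Xs i \<omega>) * w (Xs j \<omega>)) \<le> expectation (\<lambda>_. 1)"
      using abs_mult_le_1[OF b b]
      by (intro integral_mono integrable_bounded[where B = 1] borel_measurable_times m[of _ n] ij)
        (auto simp: abs_le_iff)
    then show ?thesis using True by (simp add: prob_space)
  next
    case False
    have "indep_vars (\<lambda>_. borel) (\<lambda>i \<omega>. w (Xs i \<omega>)) {i, j}"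
      using ij by (intro indep_vars_compose2[OF indep_vars_subset[OF X_indep]]) auto
    from indep_vars_lebesgue_integral[OF _ this] False
    have "expectation (\<lambda>\<omega>. w (Xs i \<omega>) * w (Xs j \<omega>)) = expectation (\<lambda>\<omega>. w (Xs i \<omega>)) * expectation (\<lambda>\<omega>. w (Xs j \<omega>))"
      using ij m[of _ n] b by (auto intro!: integrable_bounded[where B = 1])
    also have "expectation (\<lambda>\<omega>. w (Xs i \<omega>)) = 0"
      using ij mean by (subst expectation_X) auto
    finally show ?thesis by simp
  qed
  have sm: "expectation (\<lambda>\<omega>. \<bar>1 / real n * (\<Sum>i=1..n. w (Xs i \<omega>))\<bar> ^ 2) \<le> (\<Sum>i=1..n. \<Sum>j=1..n. of_bool (i = j)) / (real n)\<^sup>2"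
    "integrable M (\<lambda>\<omega>. \<bar>1 / real n * (\<Sum>i=1..n. w (Xs i \<omega>))\<bar> ^ 2)" for n
    by (rule expectation_average_square_le(1)[OF m b le] expectation_average_square_le(2)[OF m b le]; assumption)+
  show "eventually (\<lambda>n. integrable M (\<lambda>\<omega>. \<bar>1 / real n * (\<Sum>i=1..n. w (Xs i \<omega>))\<bar> ^ 2)) sequentially"
    by (intro always_eventually allI sm)
  show "(\<lambda>n. expectation (\<lambda>\<omega>. \<bar>1 / real n * (\<Sum>i=1..n. w (Xs i \<omega>))\<bar> ^ 2)) \<longlonglongrightarrow> 0"
  proof (rule tendsto_0_squeeze)
    show "eventually (\<lambda>n. expectation (\<lambda>\<omega>. \<bar>1 / real n * (\<Sum>i=1..n. w (Xs i \<omega>))\<bar> ^ 2) \<le> 1 / real n) sequentially"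
    proof (intro always_eventually allI)
      fix n
      have "(\<Sum>i=1..n. \<Sum>j=1..n. of_bool (i = j)) / (real n)\<^sup>2 = 1 / real n"
        by (simp add: power2_eq_square)
      with sm(1)[of n] show "expectation (\<lambda>\<omega>. \<bar>1 / real n * (\<Sum>i=1..n. w (Xs i \<omega>))\<bar> ^ 2) \<le> 1 / real n"
        by (simp only:)
    qed
    show "(\<lambda>n. 1 / real n) \<longlonglongrightarrow> 0" by (rule lim_const_over_n)
  qed simp
qed (auto intro: prob_space_axioms)

lemma p_hat_measurable:
  assumes n: "n \<ge> 2"
  shows "(\<lambda>\<omega>. p_hat (\<lambda>i. Xs i \<omega>) (\<lambda>i. f (Xs i \<omega>) (Us i \<omega>)) n k l) \<in> borel_measurable M"
proof -
  have "(\<lambda>\<omega>. of_bool (f (Xs i \<omega>) (Us i \<omega>) = k \<and> f (Xs (nn n i \<omega>) \<omega>) (Us (nn n i \<omega>) \<omega>) = l) :: real) \<in> borel_measurable M"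
    if i: "i \<in> {1..n}" for i
  proof (rule at_nn_measurable[OF i n])
    fix j assume j: "j \<in> {1..n}"
    have "i \<ge> 1" "j \<ge> 1" using i j by auto
    note [measurable] = this[THEN f_sample_measurable]
    show "(\<lambda>\<omega>. of_bool (f (Xs i \<omega>) (Us i \<omega>) = k \<and> f (Xs j \<omega>) (Us j \<omega>) = l) :: real) \<in> borel_measurable M"
      by measurable
  qed
  then show ?thesis unfolding p_hat_def nn_def[symmetric]
    by (intro borel_measurable_times borel_measurable_const borel_measurable_sum)
qed

lemma p_hat_tendsto:
  assumes "nn_regular l"
  shows "tendsto_in_prob M (\<lambda>n \<omega>. p_hat (\<lambda>i. Xs i \<omega>) (\<lambda>i. f (Xs i \<omega>) (Us i \<omega>)) n k l)
    (\<lambda>_. \<integral>x. q k x * q l x \<partial>PX)"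
proof -
  define c where "c = (\<integral>x. q k x * q l x \<partial>PX)"
  have b: "0 \<le> q k x * q l x" "q k x * q l x \<le> 1" for x
    using q_nonneg q_le_1 by (auto intro: mult_le_one)
  have int: "integrable PX (\<lambda>x. q k x * q l x)"
    by (intro PX.integrable_bounded[where B = 1]) (use b in auto)
  have c: "0 \<le> c" "c \<le> 1"
  proof -
    show "0 \<le> c" unfolding c_def using b by (intro integral_nonneg_AE) auto
    have "c \<le> (\<integral>x. 1 \<partial>PX)" unfolding c_def using b int by (intro integral_mono) auto
    then show "c \<le> 1" using PX.prob_space by simp
  qed
  \<comment> \<open>Residual, bias, centred average and limit, indexed by 0, ..., 3 so that the
    result on finite sums covers them together. In the third average, c is subtracted from each
    summand.\<close>
  define Z where "Z = (\<lambda>t n \<omega>. if t = (0::nat) then 1 / real n * (\<Sum>i=1..n. nn_resid k l n i \<omega>)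
    else if t = 1 then 1 / real n * (\<Sum>i=1..n. q k (Xs i \<omega>) * (q l (Xn n i \<omega>) - q l (Xs i \<omega>)))
    else if t = 2 then 1 / real n * (\<Sum>i=1..n. q k (Xs i \<omega>) * q l (Xs i \<omega>) - c) else c)"
  have "tendsto_in_prob M (\<lambda>n \<omega>. \<Sum>t\<in>{0,1,2,3}. Z t n \<omega>) (\<lambda>_. \<Sum>t\<in>{0,1,2,3::nat}. if t = 3 then c else 0)"
  proof (rule tendsto_in_prob_sum)
    fix t :: nat assume "t \<in> {0,1,2,3}"
    then consider "t = 0" | "t = 1" | "t = 2" | "t = 3" by blast
    then show "tendsto_in_prob M (Z t) (\<lambda>_. if t = 3 then c else 0)"
    proof cases
      case 1 with nn_resid_average_tendsto[of k l] show ?thesis by (simp add: Z_def)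
    next
      case 2 with bias_average_tendsto[OF assms, of k] show ?thesis by (simp add: Z_def)
    next
      case 3
      have "(\<integral>x. q k x * q l x - c \<partial>PX) = 0"
        using int PX.prob_space by (subst Bochner_Integration.integral_diff) (auto simp: c_def)
      moreover have "\<bar>q k x * q l x - c\<bar> \<le> 1" for x using b[of x] c by (simp add: abs_le_iff)
      ultimately have "tendsto_in_prob M (\<lambda>n \<omega>. 1 / real n * (\<Sum>i=1..n. q k (Xs i \<omega>) * q l (Xs i \<omega>) - c)) (\<lambda>_. 0)"
        by (intro X_average_tendsto) measurable
      with 3 show ?thesis by (simp add: Z_def)
    next
      case 4 then show ?thesis by (simp add: Z_def tendsto_in_prob_def)
    qed
    show "eventually (\<lambda>n. Z t n \<in> borel_measurable M) sequentially"
      using eventually_ge_at_top[of 2]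
    proof eventually_elim
      case (elim n)
      have m: "Xs i \<in> borel_measurable M" "Xn n i \<in> borel_measurable M" "nn_resid k l n i \<in> borel_measurable M"
        if "i \<in> {1..n}" for i
        using that elim by (auto intro: X_measurable Xn_measurable nn_resid_measurable)
      have "(\<lambda>\<omega>. q k (Xs i \<omega>) * (q l (Xn n i \<omega>) - q l (Xs i \<omega>))) \<in> borel_measurable M"
        "(\<lambda>\<omega>. q k (Xs i \<omega>) * q l (Xs i \<omega>) - c) \<in> borel_measurable M" if "i \<in> {1..n}" for i
      proof -
        note [measurable] = m[OF that]
        show "(\<lambda>\<omega>. q k (Xs i \<omega>) * (q l (Xn n i \<omega>) - q l (Xs i \<omega>))) \<in> borel_measurable M"
          "(\<lambda>\<omega>. q k (Xs i \<omega>) * q l (Xs i \<omega>) - c) \<in> borel_measurable M" by measurable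
      qed
      then show ?case unfolding Z_def using m(3)
        by (auto intro!: borel_measurable_times borel_measurable_divide borel_measurable_sum)
    qed
  qed (auto intro: finite_measure_axioms)
  then show ?thesis
  proof (rule tendsto_in_prob_cong[rotated 2])
    show "eventually (\<lambda>n. \<forall>\<omega>\<in>space M. (\<Sum>t\<in>{0,1,2,3}. Z t n \<omega>) =
        p_hat (\<lambda>i. Xs i \<omega>) (\<lambda>i. f (Xs i \<omega>) (Us i \<omega>)) n k l) sequentially"
      using eventually_ge_at_top[of 2]
    proof eventually_elim
      case (elim n)
      show ?case
      proof
        fix \<omega>
        have "c = 1 / real n * (\<Sum>i=1..n. c)" using elim by simp
        then have "(\<Sum>t\<in>{0,1,2,3}. Z t n \<omega>) = 1 / real n * (\<Sum>i=1..n. nn_resid k l n i \<omega> +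
          q k (Xs i \<omega>) * (q l (Xn n i \<omega>) - q l (Xs i \<omega>)) + (q k (Xs i \<omega>) * q l (Xs i \<omega>) - c) + c)"
          unfolding sum.distrib by (simp add: Z_def distrib_left)
        also have "\<dots> = p_hat (\<lambda>i. Xs i \<omega>) (\<lambda>i. f (Xs i \<omega>) (Us i \<omega>)) n k l"
          unfolding p_hat_def
          by (intro arg_cong2[where f = "(*)"] sum.cong refl)
            (simp add: nn_resid_def resid_def Xn_def nn_def algebra_simps)
        finally show "(\<Sum>t\<in>{0,1,2,3}. Z t n \<omega>) = p_hat (\<lambda>i. Xs i \<omega>) (\<lambda>i. f (Xs i \<omega>) (Us i \<omega>)) n k l" .
      qed
    qed
    show "(\<Sum>t\<in>{0,1,2,3::nat}. if t = 3 then c else 0) = (\<integral>x. q k x * q l x \<partial>PX)"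
      by (simp add: c_def)
  qed
qed

text \<open>Coupling two points x and y through the same noise bounds |q l x - q l y| by the
  probability that f x u and f y u differ. After Fubini, condition (a) treats the inner expectation
  for almost every u, and dominated convergence the integral over u.\<close>

lemma nn_regular_if_f_tendsto:
  assumes "AE u in PU. tendsto_in_prob M (\<lambda>n \<omega>. real (f (Xn n 1 \<omega>) u)) (\<lambda>\<omega>. real (f (Xs 1 \<omega>) u))"
  shows "nn_regular l"
  unfolding nn_regular_def
proof (rule LIMSEQ_offset[of _ 2], rule tendsto_0_squeeze)
  interpret MPU: pair_prob_space M PU ..
  have m [measurable]: "Xs 1 \<in> borel_measurable M" "Xn (n + 2) 1 \<in> borel_measurable M" for n
    by (auto intro!: X_measurable Xn_measurable)
  let ?d = "\<lambda>n \<omega> u. of_bool (f (Xn (n + 2) 1 \<omega>) u \<noteq> f (Xs 1 \<omega>) u) :: real"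
  have neq: "(\<lambda>x. of_bool (g x \<noteq> h x) :: real) \<in> borel_measurable N"
    if g: "g \<in> measurable N (count_space UNIV)" and h: "h \<in> measurable N (count_space UNIV)"
    for g h :: "'c \<Rightarrow> nat" and N
    by (rule measurable_compose_countable[OF _ g, of "\<lambda>j x. of_bool (j \<noteq> h x)"]) (use h in measurable)
  have dm: "(\<lambda>(\<omega>, u). ?d n \<omega> u) \<in> borel_measurable (M \<Otimes>\<^sub>M PU)" for n
    unfolding split_beta by (rule neq; measurable)
  have dm1: "?d n \<omega> \<in> borel_measurable PU" for n \<omega>
    by (rule neq; measurable)
  have dm2: "(\<lambda>\<omega>. ?d n \<omega> u) \<in> borel_measurable M" for n u
    by (rule neq; measurable)
  have dint: "integrable (M \<Otimes>\<^sub>M PU) (\<lambda>(\<omega>, u). ?d n \<omega> u)" for n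
    by (intro MPU.integrable_bounded[where B = 1] dm) auto
  have le: "\<bar>q l (Xn (n + 2) 1 \<omega>) - q l (Xs 1 \<omega>)\<bar> \<le> (\<integral>u. ?d n \<omega> u \<partial>PU)" for n \<omega>
  proof -
    have i: "integrable PU (\<lambda>u. of_bool (f x u = l) :: real)" for x
      by (intro PU.integrable_bounded[where B = 1]) auto
    have "\<bar>q l (Xn (n + 2) 1 \<omega>) - q l (Xs 1 \<omega>)\<bar> =
      \<bar>\<integral>u. of_bool (f (Xn (n + 2) 1 \<omega>) u = l) - of_bool (f (Xs 1 \<omega>) u = l) \<partial>PU\<bar>"
      unfolding q_def using i by (subst Bochner_Integration.integral_diff) auto
    also have "\<dots> \<le> (\<integral>u. \<bar>of_bool (f (Xn (n + 2) 1 \<omega>) u = l) - of_bool (f (Xs 1 \<omega>) u = l)\<bar> \<partial>PU)"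
      by (rule integral_abs_bound)
    also have "\<dots> \<le> (\<integral>u. ?d n \<omega> u \<partial>PU)"
      using i dm1 by (intro integral_mono integrable_abs Bochner_Integration.integrable_diff
        PU.integrable_bounded[where B = 1]) (auto simp: of_bool_def)
    finally show ?thesis .
  qed
  show "eventually (\<lambda>n. expectation (\<lambda>\<omega>. \<bar>q l (Xn (n + 2) 1 \<omega>) - q l (Xs 1 \<omega>)\<bar>) \<le>
     (\<integral>u. expectation (\<lambda>\<omega>. ?d n \<omega> u) \<partial>PU)) sequentially"
  proof (intro always_eventually allI)
    fix n
    have "expectation (\<lambda>\<omega>. \<bar>q l (Xn (n + 2) 1 \<omega>) - q l (Xs 1 \<omega>)\<bar>) \<le> expectation (\<lambda>\<omega>. \<integral>u. ?d n \<omega> u \<partial>PU)"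
    proof (intro integral_mono le)
      show "integrable M (\<lambda>\<omega>. \<integral>u. ?d n \<omega> u \<partial>PU)" by (rule MPU.integrable_fst[OF dint])
      have abs1: "\<bar>q l x - q l y\<bar> \<le> 1" for x y
        using q_nonneg[of l x] q_le_1[of l x] q_nonneg[of l y] q_le_1[of l y] by (simp add: abs_le_iff)
      show "integrable M (\<lambda>\<omega>. \<bar>q l (Xn (n + 2) 1 \<omega>) - q l (Xs 1 \<omega>)\<bar>)"
        by (intro integrable_bounded[where B = 1]) (measurable, simp add: abs1)
    qed
    also have "\<dots> = (\<integral>u. expectation (\<lambda>\<omega>. ?d n \<omega> u) \<partial>PU)"
      by (rule MPU.Fubini_integral[OF dint, symmetric])
    finally show "expectation (\<lambda>\<omega>. \<bar>q l (Xn (n + 2) 1 \<omega>) - q l (Xs 1 \<omega>)\<bar>) \<le> (\<integral>u. expectation (\<lambda>\<omega>. ?d n \<omega> u) \<partial>PU)" .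
  qed
  have "(\<lambda>n. \<integral>u. expectation (\<lambda>\<omega>. ?d n \<omega> u) \<partial>PU) \<longlonglongrightarrow> (\<integral>u. 0 \<partial>PU)"
  proof (rule integral_dominated_convergence[where w = "\<lambda>_. 1"])
    show "AE u in PU. (\<lambda>n. expectation (\<lambda>\<omega>. ?d n \<omega> u)) \<longlonglongrightarrow> 0"
      using assms
    proof eventually_elim
      case (elim u)
      \<comment> \<open>Distinct natural numbers are at distance at least 1, so the threshold 1/2
        detects exactly the event that the two levels differ.\<close>
      then have "(\<lambda>n. prob {\<omega>\<in>space M. dist (real (f (Xn n 1 \<omega>) u)) (real (f (Xs 1 \<omega>) u)) > 1/2}) \<longlonglongrightarrow> 0"
        unfolding tendsto_in_prob_def by (rule allE[of _ "1/2"]) simp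
      then have lim: "(\<lambda>n. prob {\<omega>\<in>space M. dist (real (f (Xn (n + 2) 1 \<omega>) u)) (real (f (Xs 1 \<omega>) u)) > 1/2}) \<longlonglongrightarrow> 0"
        by (rule LIMSEQ_ignore_initial_segment)
      have "prob {\<omega>\<in>space M. dist (real (f (Xn (n + 2) 1 \<omega>) u)) (real (f (Xs 1 \<omega>) u)) > 1/2} = expectation (\<lambda>\<omega>. ?d n \<omega> u)" for n
      proof -
        have eq: "{\<omega>\<in>space M. dist (real (f (Xn (n + 2) 1 \<omega>) u)) (real (f (Xs 1 \<omega>) u)) > 1/2} =
          {\<omega>\<in>space M. f (Xn (n + 2) 1 \<omega>) u \<noteq> f (Xs 1 \<omega>) u}"
        proof -
          have "(dist (real a) (real b) > 1/2) = (a \<noteq> b)" for a b :: nat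
            by (cases a b rule: linorder_cases) (auto simp: dist_real_def)
          then show ?thesis by (simp only:)
        qed
        have "{\<omega>\<in>space M. f (Xn (n + 2) 1 \<omega>) u \<noteq> f (Xs 1 \<omega>) u} = (\<lambda>\<omega>. ?d n \<omega> u) -` {1} \<inter> space M"
          by auto
        then have "{\<omega>\<in>space M. f (Xn (n + 2) 1 \<omega>) u \<noteq> f (Xs 1 \<omega>) u} \<in> sets M"
          using measurable_sets[OF dm2[of n u], of "{1}"] by simp
        then show ?thesis unfolding eq by (rule prob_eq_expectation)
      qed
      with lim show "(\<lambda>n. expectation (\<lambda>\<omega>. ?d n \<omega> u)) \<longlonglongrightarrow> 0" by simp
    qed
    show "(\<lambda>u. expectation (\<lambda>\<omega>. ?d n \<omega> u)) \<in> borel_measurable PU" for n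
      using MPU.integrable_snd[OF dint[of n]] by simp
    show "AE u in PU. norm (expectation (\<lambda>\<omega>. ?d n \<omega> u)) \<le> 1" for n
    proof (intro always_eventually allI)
      fix u
      have "expectation (\<lambda>\<omega>. ?d n \<omega> u) \<le> expectation (\<lambda>_. 1)"
        by (intro integral_mono integrable_bounded[where B = 1] dm2) auto
      moreover have "0 \<le> expectation (\<lambda>\<omega>. ?d n \<omega> u)" by (intro integral_nonneg_AE) auto
      ultimately show "norm (expectation (\<lambda>\<omega>. ?d n \<omega> u)) \<le> 1" by (simp add: prob_space)
    qed
  qed auto
  then show "(\<lambda>n. \<integral>u. expectation (\<lambda>\<omega>. ?d n \<omega> u) \<partial>PU) \<longlonglongrightarrow> 0" by simp
qed simp

text \<open>Continuity is known for the version \<open>g\<close>, while \<open>q l\<close> merely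
  equals it outside a P_X-null set and may be discontinuous. Almost surely no sample point lies in
  that set, so the two agree at X_1 and at all its neighbours, and continuity of \<open>g\<close> at
  X_1 is enough.\<close>

lemma nn_regular_if_AE_continuous:
  assumes g: "AE x in PX. g x = q l x" and cont: "AE x in PX. isCont g x"
  shows "nn_regular l"
  unfolding nn_regular_def
proof (rule LIMSEQ_offset[of _ 2])
  have m [measurable]: "Xs 1 \<in> borel_measurable M" "Xn (n + 2) 1 \<in> borel_measurable M" for n
    by (auto intro!: X_measurable Xn_measurable)
  have AE_X: "AE \<omega> in M. P (Xs j \<omega>)" if "AE x in PX. P x" "j \<ge> 1" for P j
    using that X_law[OF that(2)] X_measurable[OF that(2)] by (auto intro: AE_distrD)
  have "AE \<omega> in M. g (Xs (Suc j) \<omega>) = q l (Xs (Suc j) \<omega>)" for j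
    by (rule AE_X[OF g]) simp
  \<comment> \<open>The index of the neighbour is random, so agreement is required at all sample
    points simultaneously; \<open>Suc j\<close> runs over the indices from 1 on.\<close>
  then have all: "AE \<omega> in M. \<forall>j. g (Xs (Suc j) \<omega>) = q l (Xs (Suc j) \<omega>)"
    by (simp add: AE_all_countable)
  have abs1: "\<bar>q l x - q l y\<bar> \<le> 1" for x y
    using q_nonneg[of l x] q_le_1[of l x] q_nonneg[of l y] q_le_1[of l y] by (simp add: abs_le_iff)
  have meas: "(\<lambda>\<omega>. \<bar>q l (Xn (n + 2) 1 \<omega>) - q l (Xs 1 \<omega>)\<bar>) \<in> borel_measurable M" for n by measurable
  have "(\<lambda>n. expectation (\<lambda>\<omega>. \<bar>q l (Xn (n + 2) 1 \<omega>) - q l (Xs 1 \<omega>)\<bar>)) \<longlonglongrightarrow> expectation (\<lambda>_. 0)"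
  proof (rule integral_dominated_convergence[where w = "\<lambda>_. 1"])
    show "AE \<omega> in M. (\<lambda>n. \<bar>q l (Xn (n + 2) 1 \<omega>) - q l (Xs 1 \<omega>)\<bar>) \<longlonglongrightarrow> 0"
      using all AE_neighbour_tendsto AE_X[OF cont order.refl]
    proof eventually_elim
      case (elim \<omega>)
      have gq: "g (Xs j \<omega>) = q l (Xs j \<omega>)" if "j \<ge> 1" for j
        using elim(1) that by (cases j) auto
      have "(\<lambda>n. Xn (n + 2) 1 \<omega>) \<longlonglongrightarrow> Xs 1 \<omega>"
        using LIMSEQ_ignore_initial_segment[OF elim(2), of 2]
        by (subst tendsto_dist_iff) (simp add: dist_commute)
      from isCont_tendsto_compose[OF elim(3) this]
      have "(\<lambda>n. g (Xn (n + 2) 1 \<omega>)) \<longlonglongrightarrow> g (Xs 1 \<omega>)" .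
      moreover have "g (Xn (n + 2) 1 \<omega>) = q l (Xn (n + 2) 1 \<omega>)" for n
        unfolding Xn_def by (rule gq) (use nn_in[of "n + 2" 1 \<omega>] in simp)
      moreover have "g (Xs 1 \<omega>) = q l (Xs 1 \<omega>)" by (rule gq) simp
      ultimately have "(\<lambda>n. q l (Xn (n + 2) 1 \<omega>)) \<longlonglongrightarrow> q l (Xs 1 \<omega>)" by simp
      then have "(\<lambda>n. q l (Xn (n + 2) 1 \<omega>) - q l (Xs 1 \<omega>)) \<longlonglongrightarrow> 0" by (simp add: LIM_zero)
      then show ?case by (rule tendsto_rabs_zero)
    qed
    show "AE \<omega> in M. norm \<bar>q l (Xn (n + 2) 1 \<omega>) - q l (Xs 1 \<omega>)\<bar> \<le> 1" for n using abs1 by simp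
  qed (use meas in auto)
  then show "(\<lambda>n. expectation (\<lambda>\<omega>. \<bar>q l (Xn (n + 2) 1 \<omega>) - q l (Xs 1 \<omega>)\<bar>)) \<longlonglongrightarrow> 0" by simp
qed

end

section \<open>Consistency of the coefficient\<close>

lemma p_hat_cong:
  assumes "n \<ge> 2" "\<And>i. i \<in> {1..n} \<Longrightarrow> y i = y' i"
  shows "p_hat x y n k l = p_hat x y' n k l"
proof -
  have "y i = y' i \<and> y (nn_index x n i) = y' (nn_index x n i)" if "i \<in> {1..n}" for i
    using that nn_index_props(1)[OF assms(1), of x i] assms(2) by blast
  then show ?thesis unfolding p_hat_def by (intro arg_cong2[where f = "(*)"] sum.cong refl) simp
qed

text \<open>For n \<ge> 2 neighbours do not leave {1..n}, so only the labels there matter. This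
  allows the labels to be exchanged for values of \<open>f\<close>, with which they agree from index
  1 on.\<close>

lemma psi_hat_cong:
  assumes "n \<ge> 2" "\<And>i. i \<in> {1..n} \<Longrightarrow> y i = y' i"
  shows "psi_hat K x y n = psi_hat K x y' n"
proof -
  have "p_hat x y n k l = p_hat x y' n k l" for k l by (rule p_hat_cong[OF assms])
  then show ?thesis unfolding psi_hat_def p_hat_row_def q_hat_col_def by simp
qed

context nn_sample begin

definition pair_prob :: "nat \<Rightarrow> nat \<Rightarrow> real" where
  "pair_prob k l = (\<integral>x. q k x * q l x \<partial>PX)"

definition level_prob :: "nat \<Rightarrow> real" where
  "level_prob k = (\<integral>x. q k x \<partial>PX)"

lemma pair_prob_commute: "pair_prob k l = pair_prob l k"
  by (simp add: pair_prob_def mult.commute)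

text \<open>The levels exhaust the mass at almost every x, so the second factor sums to 1. With the
  symmetry of \<open>pair_prob\<close> this gives the limits of the row sums and of the column sums
  alike.\<close>

lemma sum_pair_prob:
  assumes "AE x in PX. (\<Sum>l=1..K. q l x) = 1"
  shows "(\<Sum>l=1..K. pair_prob k l) = level_prob k"
proof -
  have int: "integrable PX (\<lambda>x. q k x * q l x)" for l
    by (intro PX.integrable_bounded[where B = 1] abs_mult_le_1 abs_q_le_1) measurable
  have "(\<Sum>l=1..K. pair_prob k l) = (\<integral>x. (\<Sum>l=1..K. q k x * q l x) \<partial>PX)"
    unfolding pair_prob_def by (rule Bochner_Integration.integral_sum[symmetric]) (rule int)
  also have "\<dots> = level_prob k"
    unfolding level_prob_def
    by (rule integral_cong_AE) (use assms in \<open>auto simp: sum_distrib_left[symmetric] elim!: eventually_mono\<close>)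
  finally show ?thesis .
qed

lemma psi_hat_tendsto:
  assumes reg: "\<And>l. l \<in> {1..K} \<Longrightarrow> nn_regular l"
    and total: "AE x in PX. (\<Sum>l=1..K. q l x) = 1"
    and pos: "\<And>k. k \<in> {1..K} \<Longrightarrow> level_prob k > 0"
  shows "tendsto_in_prob M (\<lambda>n \<omega>. psi_hat K (\<lambda>i. Xs i \<omega>) (\<lambda>i. f (Xs i \<omega>) (Us i \<omega>)) n)
    (\<lambda>_. 1 / (real K - 1) * (\<Sum>k=1..K. \<Sum>l=1..K.
      (pair_prob k l - level_prob k * level_prob l)\<^sup>2 / (level_prob k * level_prob l)))"
proof -
  have fin: "finite_measure M" by (rule finite_measure_axioms)
  define P where "P k l n \<omega> = p_hat (\<lambda>i. Xs i \<omega>) (\<lambda>i. f (Xs i \<omega>) (Us i \<omega>)) n k l" for k l n \<omega>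
  have Pm: "eventually (\<lambda>n. P k l n \<in> borel_measurable M) sequentially" for k l
    unfolding P_def[abs_def] using eventually_ge_at_top[of 2] by eventually_elim (rule p_hat_measurable)
  have P: "tendsto_in_prob M (P k l) (\<lambda>_. pair_prob k l)" if "l \<in> {1..K}" for k l
    unfolding P_def[abs_def] pair_prob_def by (rule p_hat_tendsto[OF reg[OF that]])
  define R where "R k n \<omega> = (\<Sum>l=1..K. P k l n \<omega>)" for k n \<omega>
  define C where "C l n \<omega> = (\<Sum>k=1..K. P k l n \<omega>)" for l n \<omega>
  have "eventually (\<lambda>n. \<forall>l\<in>{1..K}. P k l n \<in> borel_measurable M) sequentially" for k
    by (intro eventually_ball_finite) (auto intro: Pm)
  then have Rm: "eventually (\<lambda>n. R k n \<in> borel_measurable M) sequentially" for k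
    unfolding R_def[abs_def] by (rule eventually_mono) (intro borel_measurable_sum, blast)
  have "eventually (\<lambda>n. \<forall>k\<in>{1..K}. P k l n \<in> borel_measurable M) sequentially" for l
    by (intro eventually_ball_finite) (auto intro: Pm)
  then have Cm: "eventually (\<lambda>n. C l n \<in> borel_measurable M) sequentially" for l
    unfolding C_def[abs_def] by (rule eventually_mono) (intro borel_measurable_sum, blast)
  have R: "tendsto_in_prob M (R k) (\<lambda>_. level_prob k)" for k
    unfolding R_def[abs_def] sum_pair_prob[OF total, of k, symmetric]
    by (intro tendsto_in_prob_sum fin P Pm) auto
  have C: "tendsto_in_prob M (C l) (\<lambda>_. level_prob l)" if "l \<in> {1..K}" for l
    unfolding C_def[abs_def] sum_pair_prob[OF total, of l, symmetric] pair_prob_commute[of l]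
    by (intro tendsto_in_prob_sum fin P Pm that) auto
  have ev: "eventually (\<lambda>n. {\<omega>\<in>space M. dist (Z n \<omega>) a > e} \<in> sets M) sequentially"
    if "eventually (\<lambda>n. Z n \<in> borel_measurable M) sequentially"
    for Z :: "nat \<Rightarrow> 'w \<Rightarrow> 'b::{metric_space, second_countable_topology}" and a e
    using that
  proof eventually_elim
    case (elim n)
    note [measurable] = elim
    show ?case by measurable
  qed
  have RCm: "eventually (\<lambda>n. (\<lambda>\<omega>. (R k n \<omega>, C l n \<omega>)) \<in> borel_measurable M) sequentially" for k l
    using Rm[of k] Cm[of l] by eventually_elim (rule borel_measurable_Pair)
  have RC: "tendsto_in_prob M (\<lambda>n \<omega>. (R k n \<omega>, C l n \<omega>)) (\<lambda>_. (level_prob k, level_prob l))"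
    if "l \<in> {1..K}" for k l
    using tendsto_in_prob_const_compose2[OF fin R C[OF that] ev[OF Rm] ev[OF Cm], of k "\<lambda>z. z"] by simp
  \<comment> \<open>The summand as a function of the pair, row and column frequencies. At the limit
    point both level probabilities are positive, so \<open>g\<close> is continuous there and the
    convention for zero denominators is invisible nearby.\<close>
  define g where "g z = (fst z - fst (snd z) * snd (snd z))\<^sup>2 / (fst (snd z) * snd (snd z))"
    for z :: "real \<times> real \<times> real"
  have T: "tendsto_in_prob M (\<lambda>n \<omega>. g (P k l n \<omega>, R k n \<omega>, C l n \<omega>))
      (\<lambda>_. g (pair_prob k l, level_prob k, level_prob l))"
    if "k \<in> {1..K}" "l \<in> {1..K}" for k l
  proof (rule tendsto_in_prob_const_compose2[OF fin P RC ev[OF Pm] ev[OF RCm]])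
    show "isCont g (pair_prob k l, level_prob k, level_prob l)"
      unfolding g_def using pos[OF that(1)] pos[OF that(2)] by (intro continuous_intros) auto
  qed (use that in auto)
  have Tm: "eventually (\<lambda>n. (\<lambda>\<omega>. g (P k l n \<omega>, R k n \<omega>, C l n \<omega>)) \<in> borel_measurable M) sequentially" for k l
    using Pm[of k l] Rm[of k] Cm[of l]
  proof eventually_elim
    case (elim n)
    note [measurable] = elim
    show ?case unfolding g_def by measurable
  qed
  define S where "S n \<omega> = (\<Sum>p\<in>{1..K} \<times> {1..K}. g (P (fst p) (snd p) n \<omega>, R (fst p) n \<omega>, C (snd p) n \<omega>))" for n \<omega>
  have "tendsto_in_prob M S
      (\<lambda>_. \<Sum>p\<in>{1..K} \<times> {1..K}. g (pair_prob (fst p) (snd p), level_prob (fst p), level_prob (snd p)))"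
    unfolding S_def[abs_def] by (intro tendsto_in_prob_sum fin T Tm) auto
  moreover have "eventually (\<lambda>n. \<forall>p\<in>{1..K} \<times> {1..K}.
      (\<lambda>\<omega>. g (P (fst p) (snd p) n \<omega>, R (fst p) n \<omega>, C (snd p) n \<omega>)) \<in> borel_measurable M) sequentially"
    by (intro eventually_ball_finite) (auto intro: Tm)
  then have "eventually (\<lambda>n. S n \<in> borel_measurable M) sequentially"
    unfolding S_def[abs_def] by (rule eventually_mono) (intro borel_measurable_sum, blast)
  \<comment> \<open>The mapping result for two sequences is applied to (S, S) with a function of the
    first component, which covers multiplication by a constant.\<close>
  ultimately have "tendsto_in_prob M (\<lambda>n \<omega>. (\<lambda>z. 1 / (real K - 1) * fst z) (S n \<omega>, S n \<omega>))
    (\<lambda>_. (\<lambda>z. 1 / (real K - 1) * fst z)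
      (\<Sum>p\<in>{1..K} \<times> {1..K}. g (pair_prob (fst p) (snd p), level_prob (fst p), level_prob (snd p)),
       \<Sum>p\<in>{1..K} \<times> {1..K}. g (pair_prob (fst p) (snd p), level_prob (fst p), level_prob (snd p))))"
    by (intro tendsto_in_prob_const_compose2[OF fin] ev continuous_intros)
  then show ?thesis
    by (simp add: S_def g_def psi_hat_def p_hat_row_def q_hat_col_def P_def R_def C_def
      sum.cartesian_product split_beta)
qed

end

section \<open>From conditional probabilities to the quantile function\<close>

lemma quantile_fn_measurable:
  assumes Q: "\<And>k. k \<in> {1..K} \<Longrightarrow> Q k \<in> borel_measurable (borel :: 'a::topological_space measure)"
  shows "case_prod (quantile_fn K Q) \<in> measurable (borel \<Otimes>\<^sub>M borel) (count_space UNIV)"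
proof -
  let ?P = "\<lambda>z k. k \<in> {1..K} \<and> (\<Sum>j=1..k. Q j (fst z)) > snd z"
  \<comment> \<open>\<open>Min\<close> of the empty set is some fixed number, so the function is
    constant where no level qualifies and a \<open>LEAST\<close> of measurable conditions
    elsewhere.\<close>
  have eq: "quantile_fn K Q (fst z) (snd z) = (if \<exists>k\<in>{1..K}. (\<Sum>j=1..k. Q j (fst z)) > snd z then LEAST k. ?P z k else Min {})" for z
  proof (cases "\<exists>k\<in>{1..K}. (\<Sum>j=1..k. Q j (fst z)) > snd z")
    case True
    then have "\<exists>k. ?P z k" by blast
    from Least_Min[OF _ this] True show ?thesis by (simp add: quantile_fn_def)
  next
    case False
    then have empty: "{k \<in> {1..K}. (\<Sum>j=1..k. Q j (fst z)) > snd z} = {}" by blast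
    show ?thesis unfolding quantile_fn_def empty using False by simp
  qed
  have S: "Measurable.pred (borel \<Otimes>\<^sub>M borel) (\<lambda>z. (\<Sum>j=1..k. Q j (fst z)) > snd z)" if "k \<in> {1..K}" for k
  proof -
    have "(\<lambda>z. \<Sum>j=1..k. Q j (fst z)) \<in> borel_measurable (borel \<Otimes>\<^sub>M borel)"
      by (intro borel_measurable_sum measurable_compose[OF measurable_fst Q]) (use that in auto)
    note [measurable] = this
    show ?thesis by measurable
  qed
  have P: "Measurable.pred (borel \<Otimes>\<^sub>M borel) (\<lambda>z. ?P z k)" for k
  proof (cases "k \<in> {1..K}")
    case True with S[OF True] show ?thesis by simp
  next
    case False
    then have "(\<lambda>z. ?P z k) = (\<lambda>_. False)" by blast
    then show ?thesis by (simp only: measurable_const space_count_space UNIV_I)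
  qed
  note [measurable] = P
  have E: "Measurable.pred (borel \<Otimes>\<^sub>M borel) (\<lambda>z. \<exists>k\<in>{1..K}. (\<Sum>j=1..k. Q j (fst z)) > snd z)"
    by (intro pred_intros_finite S) auto
  have L: "(\<lambda>z. LEAST k. ?P z k) \<in> measurable (borel \<Otimes>\<^sub>M borel) (count_space UNIV)"
    by (rule measurable_Least[OF P])
  show ?thesis unfolding split_beta eq
    by (rule measurable_If[OF L]) (use E in simp_all)
qed

text \<open>Inverse transform sampling: with the partial sums \<open>S\<close>, level k is taken
  exactly for u in [S (k - 1), S k), an interval of length \<open>Q k x\<close>.\<close>

lemma measure_quantile_fn_level:
  assumes Q0: "\<And>j. j \<in> {1..K} \<Longrightarrow> 0 \<le> Q j x" and Q1: "(\<Sum>j=1..K. Q j x) = 1"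
    and k: "k \<in> {1..K}"
    and meas: "quantile_fn K Q x \<in> measurable borel (count_space UNIV)"
  shows "measure (uniform_measure lborel {0<..<1}) {u. quantile_fn K Q x u = k} = Q k x"
proof -
  define S where "S k = (\<Sum>j=1..k. Q j x)" for k
  have mono: "S i \<le> S j" if "i \<le> j" "j \<le> K" for i j
    unfolding S_def using that by (intro sum_mono2) (auto intro!: Q0)
  have S0: "S 0 = 0" and SK: "S K = 1" using Q1 by (simp_all add: S_def)
  have Sk: "S k = S (k - 1) + Q k x"
    using k unfolding S_def by (cases k) auto
  have level: "quantile_fn K Q x u = k \<longleftrightarrow> S (k - 1) \<le> u \<and> u < S k" if u: "0 \<le> u" "u < 1" for u
  proof -
    let ?A = "{k \<in> {1..K}. S k > u}"
    have "K \<in> ?A" using u SK k by auto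
    have "quantile_fn K Q x u = k \<longleftrightarrow> k \<in> ?A \<and> (\<forall>j\<in>?A. k \<le> j)"
      unfolding quantile_fn_def S_def[symmetric] using \<open>K \<in> ?A\<close>
      by (subst Min_eq_iff) auto
    also have "\<dots> \<longleftrightarrow> S (k - 1) \<le> u \<and> u < S k"
    proof (intro iffI conjI)
      assume *: "k \<in> ?A \<and> (\<forall>j\<in>?A. k \<le> j)"
      show "S (k - 1) \<le> u"
      proof (rule ccontr)
        assume "\<not> S (k - 1) \<le> u"
        \<comment> \<open>For k = 1 the predecessor 0 is not a level; \<open>S 0 = 0\<close> and u
          \<ge> 0 rule this case out.\<close>
        moreover from this have "k - 1 \<noteq> 0" using S0 u by (intro notI) simp
        ultimately have "k - 1 \<in> ?A" using k by auto
        with * have "k \<le> k - 1" by blast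
        with k show False by auto
      qed
      show "u < S k" using * by blast
    next
      assume *: "S (k - 1) \<le> u \<and> u < S k"
      then show "k \<in> ?A" using k by blast
      show "\<forall>j\<in>?A. k \<le> j"
      proof
        fix j assume j: "j \<in> ?A"
        show "k \<le> j"
        proof (rule ccontr)
          assume "\<not> k \<le> j"
          then have "S j \<le> S (k - 1)" using k by (intro mono) auto
          with * j show False by simp
        qed
      qed
    qed
    finally show ?thesis .
  qed
  define A where "A = {0<..<1} \<inter> {u. quantile_fn K Q x u = k}"
  have B: "{u. quantile_fn K Q x u = k} \<in> sets lborel"
    using measurable_sets[OF meas, of "{k}"] by (simp add: vimage_def)
  then have A: "A \<in> sets lborel" by (auto simp: A_def)
  have bounds: "0 \<le> S (k - 1)" "S (k - 1) \<le> S k" "S k \<le> 1"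
    using mono[of 0 "k - 1"] mono[of "k - 1" k] mono[of k K] S0 SK k by auto
  have A_eq: "A = {0<..<1} \<inter> {S (k - 1)..<S k}"
  proof (rule set_eqI)
    fix u
    show "u \<in> A \<longleftrightarrow> u \<in> {0<..<1} \<inter> {S (k - 1)..<S k}"
      using level[of u] by (cases "0 < u \<and> u < 1") (auto simp: A_def)
  qed
  \<comment> \<open>The open unit interval lacks 0, so the left endpoint is lost if
    \<open>S (k - 1) = 0\<close>. Sandwiching between the open and the closed interval, which have
    equal length, avoids this distinction.\<close>
  have sub: "{S (k - 1)<..<S k} \<subseteq> A" "A \<subseteq> {S (k - 1)..S k}"
    using bounds by (auto simp: A_eq)
  have fm: "{S (k - 1)..S k} \<in> fmeasurable lborel"
    using bounds by (simp add: fmeasurable_def)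
  have "measure lborel A \<le> measure lborel {S (k - 1)..S k}"
    by (intro measure_mono_fmeasurable sub A fm)
  moreover have "measure lborel {S (k - 1)<..<S k} \<le> measure lborel A"
  proof (intro measure_mono_fmeasurable sub)
    show "A \<in> fmeasurable lborel"
      by (rule fmeasurableI2[OF fm sub(2) A])
  qed simp
  ultimately have "measure lborel A = Q k x" using bounds Sk by simp
  then show ?thesis using B by (subst measure_uniform_measure) (auto simp: A_def)
qed

text \<open>The triple law needs X to be independent of the pair (U, V), while mutual independence
  concerns three separate sigma-algebras; the last two are first merged into a single one. Factoring
  the law of (U, V) then finishes the product.\<close>

lemma (in prob_space) indep3_joint_law:
  fixes X :: "'a \<Rightarrow> 'x::topological_space" and U :: "'a \<Rightarrow> 'u::topological_space"
    and V :: "'a \<Rightarrow> 'v::topological_space"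
  assumes [measurable]: "X \<in> borel_measurable M" "U \<in> borel_measurable M" "V \<in> borel_measurable M"
    and indep: "indep3 M X U V"
  shows "distr M (borel \<Otimes>\<^sub>M borel) (\<lambda>\<omega>. (X \<omega>, U \<omega>)) = distr M borel X \<Otimes>\<^sub>M distr M borel U"
    and "distr M (borel \<Otimes>\<^sub>M (borel \<Otimes>\<^sub>M borel)) (\<lambda>\<omega>. (X \<omega>, (U \<omega>, V \<omega>))) =
      distr M borel X \<Otimes>\<^sub>M (distr M borel U \<Otimes>\<^sub>M distr M borel V)"
proof -
  define E where "E i = (if i = 0 then sets (vimage_algebra (space M) X borel)
    else if i = 1 then sets (vimage_algebra (space M) U borel)
    else sets (vimage_algebra (space M) V borel))" for i :: nat
  have E: "indep_sets E {0, 1, 2}" using indep unfolding indep3_def E_def .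
  have XE: "{\<omega>\<in>space M. X \<omega> \<in> A} \<in> E 0" if "A \<in> sets borel" for A
    using in_vimage_algebra[OF that, of X "space M"] by (simp add: E_def vimage_def Int_def conj_commute)
  have UE: "{\<omega>\<in>space M. U \<omega> \<in> A} \<in> E 1" if "A \<in> sets borel" for A
    using in_vimage_algebra[OF that, of U "space M"] by (simp add: E_def vimage_def Int_def conj_commute)
  have VE: "{\<omega>\<in>space M. V \<omega> \<in> A} \<in> E 2" if "A \<in> sets borel" for A
    using in_vimage_algebra[OF that, of V "space M"] by (simp add: E_def vimage_def Int_def conj_commute)
  have two: "prob (A \<inter> B) = prob A * prob B" if "A \<in> E i" "B \<in> E j" "i \<noteq> j" "{i, j} \<subseteq> {0, 1, 2}" for A B i j
    using indep_setsD[OF E, of "{i, j}" "\<lambda>l. if l = i then A else B"] that by (auto simp: Int_commute)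
  show "distr M (borel \<Otimes>\<^sub>M borel) (\<lambda>\<omega>. (X \<omega>, U \<omega>)) = distr M borel X \<Otimes>\<^sub>M distr M borel U"
  proof (rule distr_Pair_eq)
    fix A :: "'x set" and B :: "'u set" assume "A \<in> sets borel" "B \<in> sets borel"
    from two[OF XE[OF this(1)] UE[OF this(2)]]
    show "prob {\<omega>\<in>space M. X \<omega> \<in> A \<and> U \<omega> \<in> B} = prob {\<omega>\<in>space M. X \<omega> \<in> A} * prob {\<omega>\<in>space M. U \<omega> \<in> B}"
      by (simp add: Collect_conj_eq[symmetric] conj_ac Int_def)
  qed measurable
  have UV: "distr M (borel \<Otimes>\<^sub>M borel) (\<lambda>\<omega>. (U \<omega>, V \<omega>)) = distr M borel U \<Otimes>\<^sub>M distr M borel V"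
  proof (rule distr_Pair_eq)
    fix A :: "'u set" and B :: "'v set" assume "A \<in> sets borel" "B \<in> sets borel"
    from two[OF UE[OF this(1)] VE[OF this(2)]]
    show "prob {\<omega>\<in>space M. U \<omega> \<in> A \<and> V \<omega> \<in> B} = prob {\<omega>\<in>space M. U \<omega> \<in> A} * prob {\<omega>\<in>space M. V \<omega> \<in> B}"
      by (simp add: Collect_conj_eq[symmetric] conj_ac Int_def)
  qed measurable
  \<comment> \<open>\<open>True\<close> stands for the group of X, \<open>False\<close> for the
    joint group of U and V.\<close>
  define I where "I = case_bool {0::nat} {1, 2}"
  have "indep_sets (\<lambda>b. sigma_sets (space M) (\<Union>i\<in>I b. E i)) UNIV"
  proof (rule indep_sets_collect_sigma)
    show "indep_sets E (\<Union>b\<in>UNIV. I b)"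
      by (rule indep_sets_mono_index[OF _ E]) (auto simp: I_def split: bool.splits)
    show "Int_stable (E i)" for i by (auto simp: E_def Int_stable_def)
    show "disjoint_family_on I UNIV" by (auto simp: disjoint_family_on_def I_def split: bool.splits)
  qed
  note group = this
  define G where "G = sigma (space M) (E 1 \<union> E 2)"
  have EP: "E i \<subseteq> Pow (space M)" for i
    using sets.space_closed[of "vimage_algebra (space M) X borel"]
      sets.space_closed[of "vimage_algebra (space M) U borel"]
      sets.space_closed[of "vimage_algebra (space M) V borel"] by (auto simp: E_def)
  have G: "space G = space M" "sets G = sigma_sets (space M) (E 1 \<union> E 2)"
    using EP[of 1] EP[of 2] by (simp_all add: G_def)
  have "U \<in> measurable G borel"
    using UE by (intro measurableI) (auto simp: G vimage_def Int_def conj_commute intro!: sigma_sets.Basic)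
  moreover have "V \<in> measurable G borel"
    using VE by (intro measurableI) (auto simp: G vimage_def Int_def conj_commute intro!: sigma_sets.Basic)
  ultimately have UVG: "(\<lambda>\<omega>. (U \<omega>, V \<omega>)) \<in> measurable G (borel \<Otimes>\<^sub>M borel)" by (rule measurable_Pair)
  have "distr M (borel \<Otimes>\<^sub>M (borel \<Otimes>\<^sub>M borel)) (\<lambda>\<omega>. (X \<omega>, (U \<omega>, V \<omega>))) =
      distr M borel X \<Otimes>\<^sub>M distr M (borel \<Otimes>\<^sub>M borel) (\<lambda>\<omega>. (U \<omega>, V \<omega>))"
  proof (rule distr_Pair_eq)
    fix A :: "'x set" and C :: "('u \<times> 'v) set"
    assume A: "A \<in> sets borel" and C: "C \<in> sets (borel \<Otimes>\<^sub>M borel)"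
    let ?C = "{\<omega>\<in>space M. (U \<omega>, V \<omega>) \<in> C}"
    have "?C \<in> sigma_sets (space M) (\<Union>i\<in>I False. E i)"
      using measurable_sets[OF UVG C] by (simp add: G I_def vimage_def Int_def conj_commute)
    moreover have "{\<omega>\<in>space M. X \<omega> \<in> A} \<in> sigma_sets (space M) (\<Union>i\<in>I True. E i)"
      using XE[OF A] by (auto simp: I_def)
    ultimately have "prob ({\<omega>\<in>space M. X \<omega> \<in> A} \<inter> ?C) = prob {\<omega>\<in>space M. X \<omega> \<in> A} * prob ?C"
      using indep_setsD[OF group, of UNIV "case_bool {\<omega>\<in>space M. X \<omega> \<in> A} ?C"] by (simp add: UNIV_bool Int_commute mult.commute)
    then show "prob {\<omega>\<in>space M. X \<omega> \<in> A \<and> (U \<omega>, V \<omega>) \<in> C} =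
        prob {\<omega>\<in>space M. X \<omega> \<in> A} * prob {\<omega>\<in>space M. (U \<omega>, V \<omega>) \<in> C}"
      by (simp add: Collect_conj_eq[symmetric] conj_ac Int_def)
  qed measurable
  then show "distr M (borel \<Otimes>\<^sub>M (borel \<Otimes>\<^sub>M borel)) (\<lambda>\<omega>. (X \<omega>, (U \<omega>, V \<omega>))) =
      distr M borel X \<Otimes>\<^sub>M (distr M borel U \<Otimes>\<^sub>M distr M borel V)" by (simp only: UV)
qed

text \<open>Conditional expectation is positive and additive, and the indicators of the levels sum
  to 1. There are finitely many levels, so one null set serves all of them, and the statement about
  \<open>Q k (X \<omega>)\<close> is pushed forward to the law of X.\<close>

lemma (in prob_space) AE_cond_prob_version_simplex:
  assumes X: "X \<in> borel_measurable M" and Y: "Y \<in> measurable M (count_space {1..K})"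
    and Q: "\<And>k. k \<in> {1..K} \<Longrightarrow> cond_prob_version M X Y k (Q k)"
  shows "AE x in distr M borel X. (\<forall>k\<in>{1..K}. 0 \<le> Q k x) \<and> (\<Sum>k=1..K. Q k x) = 1"
proof -
  define F where "F = vimage_algebra (space M) X borel"
  have "subalgebra M F"
    using X by (auto simp: subalgebra_def F_def sets_vimage_algebra2 intro: measurable_sets)
  then interpret finite_measure_subalgebra M F
    by unfold_locales
  have [measurable]: "Q k \<in> borel_measurable borel" if "k \<in> {1..K}" for k
    using Q[OF that] by (simp add: cond_prob_version_def)
  let ?I = "\<lambda>k. indicator {\<omega>\<in>space M. Y \<omega> = k} :: _ \<Rightarrow> real"
  have ev: "{\<omega>\<in>space M. Y \<omega> = k} \<in> sets M" for k
  proof (cases "k \<in> {1..K}")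
    case True
    then show ?thesis using measurable_sets[OF Y, of "{k}"] by (simp add: vimage_def Int_def conj_commute)
  next
    case False
    then have *: "{\<omega>\<in>space M. Y \<omega> = k} = {}" using measurable_space[OF Y] by auto
    show ?thesis unfolding * by simp
  qed
  have int: "integrable M (?I k)" for k
    by (rule integrable_bounded[where B = 1]) (use ev in \<open>auto simp: indicator_def[abs_def]\<close>)
  have eq: "AE \<omega> in M. \<forall>k\<in>{1..K}. Q k (X \<omega>) = real_cond_exp M F (?I k) \<omega>"
    using Q by (intro AE_finite_allI) (auto simp: cond_prob_version_def F_def)
  have pos: "AE \<omega> in M. \<forall>k\<in>{1..K}. 0 \<le> real_cond_exp M F (?I k) \<omega>"
    using ev by (intro AE_finite_allI real_cond_exp_pos) auto
  have sum: "AE \<omega> in M. real_cond_exp M F (\<lambda>\<omega>. \<Sum>k\<in>{1..K}. ?I k \<omega>) \<omega> = (\<Sum>k\<in>{1..K}. real_cond_exp M F (?I k) \<omega>)"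
    by (rule real_cond_exp_sum[OF int])
  have one: "AE \<omega> in M. real_cond_exp M F (\<lambda>\<omega>. \<Sum>k\<in>{1..K}. ?I k \<omega>) \<omega> = real_cond_exp M F (\<lambda>_. 1) \<omega>"
  proof (rule real_cond_exp_cong)
    show "AE \<omega> in M. (\<Sum>k\<in>{1..K}. ?I k \<omega>) = 1"
    proof (rule AE_I2)
      fix \<omega> assume "\<omega> \<in> space M"
      then have "(\<Sum>k\<in>{1..K}. ?I k \<omega>) = (\<Sum>k\<in>{1..K}. if k = Y \<omega> then 1 else 0)"
        by (intro sum.cong) (auto simp: indicator_def)
      also have "\<dots> = 1" using measurable_space[OF Y \<open>\<omega> \<in> space M\<close>] by simp
      finally show "(\<Sum>k\<in>{1..K}. ?I k \<omega>) = 1" .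
    qed
  qed (use ev in auto)
  have const: "AE \<omega> in M. real_cond_exp M F (\<lambda>_. 1) \<omega> = 1"
    by (rule real_cond_exp_F_meas) auto
  have "AE \<omega> in M. (\<forall>k\<in>{1..K}. 0 \<le> Q k (X \<omega>)) \<and> (\<Sum>k=1..K. Q k (X \<omega>)) = 1"
    using eq pos sum one const by eventually_elim simp
  then show ?thesis
    using X by (subst AE_distr_iff) (auto intro!: sets.sets_Collect sets.sets_Collect_finite_All)
qed

text \<open>A distance is nonnegative, so its distribution function vanishes to the left of 0;
  continuity at 0 keeps it small just to the right.\<close>

lemma continuous_cdf_dist_small:
  fixes X Y :: "'w \<Rightarrow> 'a::{metric_space, second_countable_topology}"
  assumes "prob_space M" and [measurable]: "X \<in> borel_measurable M" "Y \<in> borel_measurable M"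
    and cont: "continuous_on UNIV (cdf (distr M borel (\<lambda>\<omega>. dist (X \<omega>) (Y \<omega>))))"
    and e: "e > 0"
  shows "\<exists>d>0. measure M {\<omega>\<in>space M. dist (X \<omega>) (Y \<omega>) \<le> d} < e"
proof -
  define F where "F d = measure M {\<omega>\<in>space M. dist (X \<omega>) (Y \<omega>) \<le> d}" for d
  have "cdf (distr M borel (\<lambda>\<omega>. dist (X \<omega>) (Y \<omega>))) = F"
    by (rule ext) (simp add: cdf_def F_def measure_distr vimage_def Int_def conj_commute)
  with cont have "isCont F 0" by (simp add: continuous_on_eq_continuous_at)
  then obtain d where d: "d > 0" "\<And>x. dist x 0 < d \<Longrightarrow> dist (F x) (F 0) < e / 2"
    unfolding continuous_at_eps_delta using e half_gt_zero by blast
  have *: "{\<omega>\<in>space M. dist (X \<omega>) (Y \<omega>) \<le> - d / 2} = {}"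
    using d(1) by (auto simp: not_le intro: less_le_trans[OF _ zero_le_dist])
  have "F (- d / 2) = 0" unfolding F_def * by simp
  \<comment> \<open>The first bound gives F 0 < e/2, because F is 0 at -d/2; moving on to d/2 adds
    less than e/2.\<close>
  moreover have "dist (F (- d / 2)) (F 0) < e / 2" "dist (F (d / 2)) (F 0) < e / 2"
    by (rule d(2), use d(1) in \<open>simp add: dist_real_def\<close>)+
  ultimately have "F (d / 2) < e"
    unfolding dist_real_def by linarith
  then show ?thesis using d(1) unfolding F_def by (intro exI[of _ "d / 2"]) simp
qed

section \<open>Level and pair probabilities as integrals over the law of X\<close>

context nn_sample begin

lemma prob_level_eq:
  assumes XU: "(\<lambda>\<omega>. (X \<omega>, U \<omega>)) \<in> measurable M (borel \<Otimes>\<^sub>M borel)"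
    and joint: "distr M (borel \<Otimes>\<^sub>M borel) (\<lambda>\<omega>. (X \<omega>, U \<omega>)) = PX \<Otimes>\<^sub>M PU"
  shows "prob {\<omega>\<in>space M. f (X \<omega>) (U \<omega>) = k} = level_prob k"
proof -
  let ?h = "\<lambda>z. of_bool (f (fst z) (snd z) = k) :: real"
  have h: "?h \<in> borel_measurable (borel \<Otimes>\<^sub>M borel)" by measurable
  have h': "?h \<in> borel_measurable (PX \<Otimes>\<^sub>M PU)" by measurable
  have "{\<omega>\<in>space M. f (X \<omega>) (U \<omega>) = k} = (\<lambda>\<omega>. (X \<omega>, U \<omega>)) -` (?h -` {1} \<inter> space (borel \<Otimes>\<^sub>M borel)) \<inter> space M"
    by (auto simp: space_pair_measure)
  then have "{\<omega>\<in>space M. f (X \<omega>) (U \<omega>) = k} \<in> sets M"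
    using measurable_sets[OF XU measurable_sets[OF h, of "{1}"]] by simp
  then have "prob {\<omega>\<in>space M. f (X \<omega>) (U \<omega>) = k} = expectation (\<lambda>\<omega>. ?h (X \<omega>, U \<omega>))"
    by (simp add: prob_eq_expectation)
  also have "\<dots> = (\<integral>z. ?h z \<partial>(PX \<Otimes>\<^sub>M PU))"
    unfolding joint[symmetric] by (rule integral_distr[OF XU h, symmetric])
  also have "\<dots> = (\<integral>x. (\<integral>u. ?h (x, u) \<partial>PU) \<partial>PX)"
    by (rule PXU.integral_fst'[symmetric]) (intro PXU.integrable_bounded[where B = 1] h', simp)
  finally show ?thesis by (simp add: level_prob_def q_def)
qed

text \<open>The two labels share the covariate but use independent noise, so at fixed x the double
  integral over (u, v) factors. This identifies the limit of the pair frequencies with a probability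
  for (Y, Y').\<close>

lemma prob_pair_eq:
  assumes XUV: "(\<lambda>\<omega>. (X \<omega>, (U \<omega>, V \<omega>))) \<in> measurable M (borel \<Otimes>\<^sub>M (borel \<Otimes>\<^sub>M borel))"
    and joint: "distr M (borel \<Otimes>\<^sub>M (borel \<Otimes>\<^sub>M borel)) (\<lambda>\<omega>. (X \<omega>, (U \<omega>, V \<omega>))) = PX \<Otimes>\<^sub>M (PU \<Otimes>\<^sub>M PU)"
  shows "prob {\<omega>\<in>space M. f (X \<omega>) (U \<omega>) = k \<and> f (X \<omega>) (V \<omega>) = l} = pair_prob k l"
proof -
  interpret PUU: pair_prob_space PU PU ..
  interpret PXUU: pair_prob_space PX "PU \<Otimes>\<^sub>M PU" ..
  let ?h = "\<lambda>z. of_bool (f (fst z) (fst (snd z)) = k \<and> f (fst z) (snd (snd z)) = l) :: real"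
  have h: "?h \<in> borel_measurable (borel \<Otimes>\<^sub>M (borel \<Otimes>\<^sub>M borel))" by measurable
  have h': "?h \<in> borel_measurable (PX \<Otimes>\<^sub>M (PU \<Otimes>\<^sub>M PU))" by measurable
  have "{\<omega>\<in>space M. f (X \<omega>) (U \<omega>) = k \<and> f (X \<omega>) (V \<omega>) = l} =
      (\<lambda>\<omega>. (X \<omega>, (U \<omega>, V \<omega>))) -` (?h -` {1} \<inter> space (borel \<Otimes>\<^sub>M (borel \<Otimes>\<^sub>M borel))) \<inter> space M"
    by (auto simp: space_pair_measure)
  then have "{\<omega>\<in>space M. f (X \<omega>) (U \<omega>) = k \<and> f (X \<omega>) (V \<omega>) = l} \<in> sets M"
    using measurable_sets[OF XUV measurable_sets[OF h, of "{1}"]] by simp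
  then have "prob {\<omega>\<in>space M. f (X \<omega>) (U \<omega>) = k \<and> f (X \<omega>) (V \<omega>) = l} =
      expectation (\<lambda>\<omega>. ?h (X \<omega>, (U \<omega>, V \<omega>)))"
    by (simp add: prob_eq_expectation)
  also have "\<dots> = (\<integral>z. ?h z \<partial>(PX \<Otimes>\<^sub>M (PU \<Otimes>\<^sub>M PU)))"
    unfolding joint[symmetric] by (rule integral_distr[OF XUV h, symmetric])
  also have "\<dots> = (\<integral>x. (\<integral>w. ?h (x, w) \<partial>(PU \<Otimes>\<^sub>M PU)) \<partial>PX)"
    by (rule PXUU.integral_fst'[symmetric]) (intro PXUU.integrable_bounded[where B = 1] h', simp)
  also have "\<dots> = (\<integral>x. q k x * q l x \<partial>PX)"
  proof (rule Bochner_Integration.integral_cong[OF refl])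
    fix x
    have "(\<lambda>w. of_bool (f x (fst w) = k \<and> f x (snd w) = l) :: real) \<in> borel_measurable (PU \<Otimes>\<^sub>M PU)"
      by measurable
    then have m: "(\<lambda>w. ?h (x, w)) \<in> borel_measurable (PU \<Otimes>\<^sub>M PU)" by simp
    have "(\<integral>w. ?h (x, w) \<partial>(PU \<Otimes>\<^sub>M PU)) = (\<integral>u. (\<integral>v. ?h (x, (u, v)) \<partial>PU) \<partial>PU)"
      by (rule PUU.integral_fst'[symmetric]) (intro PUU.integrable_bounded[where B = 1] m, simp)
    also have "\<dots> = (\<integral>u. (\<integral>v. of_bool (f x u = k) * of_bool (f x v = l) \<partial>PU) \<partial>PU)"
      by (simp add: of_bool_conj)
    also have "\<dots> = q k x * q l x" by (simp add: q_def)
    finally show "(\<integral>w. ?h (x, w) \<partial>(PU \<Otimes>\<^sub>M PU)) = q k x * q l x" .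
  qed
  finally show ?thesis by (simp add: pair_prob_def)
qed

end

text \<open>The sampling model is instantiated with the quantile function and the uniform law. The
  link to the hypotheses is that \<open>q\<close> agrees with the versions \<open>Q\<close> almost
  everywhere, which transports both the total mass 1 and condition (b).\<close>

theorem theorem2:
  fixes M :: "'w measure"
    and K :: nat
    and X :: "'w \<Rightarrow> 'a::{metric_space, second_countable_topology}"
    and Y Y' :: "'w \<Rightarrow> nat"
    and U U' :: "'w \<Rightarrow> real"
    and Q :: "nat \<Rightarrow> 'a \<Rightarrow> real"
    and Xs :: "nat \<Rightarrow> 'w \<Rightarrow> 'a"
    and Us :: "nat \<Rightarrow> 'w \<Rightarrow> real"
    and Ys :: "nat \<Rightarrow> 'w \<Rightarrow> nat"
  assumes "prob_space M"
    and "K \<ge> 2"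
    and "X \<in> borel_measurable M"
    and "Y \<in> measurable M (count_space {1..K})"
    and "\<And>k. k \<in> {1..K} \<Longrightarrow> \<P>(\<omega> in M. Y \<omega> = k) > 0"
    and "\<And>k. k \<in> {1..K} \<Longrightarrow> cond_prob_version M X Y k (Q k)"
    and "U \<in> borel_measurable M"
    and "U' \<in> borel_measurable M"
    and "indep3 M X U U'"
    and "distr M borel U = uniform_measure lborel {0<..<1}"
    and "distr M borel U' = uniform_measure lborel {0<..<1}"
    and "AE \<omega> in M. Y \<omega> = quantile_fn K Q (X \<omega>) (U \<omega>)"
    and "\<And>\<omega>. \<omega> \<in> space M \<Longrightarrow> Y' \<omega> = quantile_fn K Q (X \<omega>) (U' \<omega>)"
    and "prob_space.indep_vars M (\<lambda>_. borel \<Otimes>\<^sub>M borel) (\<lambda>i \<omega>. (Xs i \<omega>, Us i \<omega>)) {1..}"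
    and "\<And>i. i \<ge> 1 \<Longrightarrow>
           distr M (borel \<Otimes>\<^sub>M borel) (\<lambda>\<omega>. (Xs i \<omega>, Us i \<omega>)) =
           distr M (borel \<Otimes>\<^sub>M borel) (\<lambda>\<omega>. (X \<omega>, U \<omega>))"
    and "\<And>i \<omega>. i \<ge> 1 \<Longrightarrow> \<omega> \<in> space M \<Longrightarrow> Ys i \<omega> = quantile_fn K Q (Xs i \<omega>) (Us i \<omega>)"
    and "continuous_on UNIV (cdf (distr M borel (\<lambda>\<omega>. dist (Xs 1 \<omega>) (Xs 2 \<omega>))))"
    and "(AE u in lborel. u \<in> {0<..<1} \<longrightarrow>
            tendsto_in_prob M
              (\<lambda>n \<omega>. real (quantile_fn K Q (Xs (nn_index (\<lambda>i. Xs i \<omega>) n 1) \<omega>) u))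
              (\<lambda>\<omega>. real (quantile_fn K Q (Xs 1 \<omega>) u))) \<or>
         (\<forall>k \<in> {1..K}. AE x in distr M borel X. isCont (Q k) x)"
  shows "tendsto_in_prob M
           (\<lambda>n \<omega>. psi_hat K (\<lambda>i. Xs i \<omega>) (\<lambda>i. Ys i \<omega>) n)
           (\<lambda>\<omega>. psi M K Y Y')"
proof -
  interpret prob_space M by fact
  let ?f = "quantile_fn K Q"
  define PX where "PX = distr M borel X"
  define PU where "PU = uniform_measure lborel {0<..<1::real}"
  note X = assms(3) and Y = assms(4) and U = assms(7) and U' = assms(8)
  have UPU: "distr M borel U = PU" and UPU': "distr M borel U' = PU"
    using assms(10,11) by (simp_all add: PU_def)
  have XU: "distr M (borel \<Otimes>\<^sub>M borel) (\<lambda>\<omega>. (X \<omega>, U \<omega>)) = PX \<Otimes>\<^sub>M PU"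
    and XUU: "distr M (borel \<Otimes>\<^sub>M (borel \<Otimes>\<^sub>M borel)) (\<lambda>\<omega>. (X \<omega>, (U \<omega>, U' \<omega>))) = PX \<Otimes>\<^sub>M (PU \<Otimes>\<^sub>M PU)"
    using indep3_joint_law[OF X U U' assms(9)] by (simp_all add: UPU UPU' PX_def)
  have Q: "Q k \<in> borel_measurable borel" if "k \<in> {1..K}" for k
    using assms(6)[OF that] by (simp add: cond_prob_version_def)
  have sample: "(\<lambda>\<omega>. (Xs i \<omega>, Us i \<omega>)) \<in> measurable M (borel \<Otimes>\<^sub>M borel)" if "i \<ge> 1" for i
    using assms(14) that by (auto simp: indep_vars_def)
  have Xs: "Xs i \<in> borel_measurable M" if "i \<ge> 1" for i
    using measurable_compose[OF sample[OF that] measurable_fst] by simp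
  interpret nn_sample M PX PU ?f Xs Us
  proof (intro nn_sample.intro nn_sample_axioms.intro)
    show "prob_space M" "prob_space PX" "prob_space PU"
      using assms(1) prob_space_distr[OF X] prob_space_distr[OF U] by (simp_all add: PX_def UPU)
    show "sets PX = sets borel" "sets PU = sets borel" by (simp_all add: PX_def PU_def)
    show "case_prod ?f \<in> measurable (borel \<Otimes>\<^sub>M borel) (count_space UNIV)"
      by (rule quantile_fn_measurable[OF Q])
    show "distr M (borel \<Otimes>\<^sub>M borel) (\<lambda>\<omega>. (Xs i \<omega>, Us i \<omega>)) = PX \<Otimes>\<^sub>M PU" if "1 \<le> i" for i
      using assms(15)[OF that] XU by simp
    show "\<exists>d>0. prob {\<omega>\<in>space M. dist (Xs 1 \<omega>) (Xs 2 \<omega>) \<le> d} < e" if "e > 0" for e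
      by (rule continuous_cdf_dist_small[OF assms(1) Xs Xs assms(17) that]) simp_all
  qed (rule assms(14))
  have simplex: "AE x in PX. (\<forall>k\<in>{1..K}. 0 \<le> Q k x) \<and> (\<Sum>k=1..K. Q k x) = 1"
    unfolding PX_def using X Y assms(6) by (rule AE_cond_prob_version_simplex)
  \<comment> \<open>The quantile function recovers the law prescribed by \<open>Q\<close> wherever
    the values \<open>Q k x\<close> form a probability vector, that is, at almost every x.\<close>
  have qQ: "AE x in PX. \<forall>k\<in>{1..K}. Q k x = q k x"
    using simplex
  proof eventually_elim
    case (elim x)
    have "measure PU {u. ?f x u = k} = Q k x" if "k \<in> {1..K}" for k
      unfolding PU_def using elim that f_section by (intro measure_quantile_fn_level) auto
    moreover have "q k x = measure PU {u. ?f x u = k}" for k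
    proof -
      have "{u\<in>space PU. ?f x u = k} \<in> sets PU" by measurable
      from PU.prob_eq_expectation[OF this] show ?thesis by (simp add: q_def)
    qed
    ultimately show ?case by simp
  qed
  have total: "AE x in PX. (\<Sum>l=1..K. q l x) = 1"
    using simplex qQ by eventually_elim simp
  have XUm: "(\<lambda>\<omega>. (X \<omega>, U \<omega>)) \<in> measurable M (borel \<Otimes>\<^sub>M borel)"
    and XUUm: "(\<lambda>\<omega>. (X \<omega>, (U \<omega>, U' \<omega>))) \<in> measurable M (borel \<Otimes>\<^sub>M (borel \<Otimes>\<^sub>M borel))"
    using X U U' by (auto intro: measurable_Pair)
  have Yev: "{\<omega>\<in>space M. Y \<omega> = k} \<in> sets M" if "k \<in> {1..K}" for k
    using measurable_sets[OF Y, of "{k}"] that by (simp add: vimage_def Int_def conj_commute)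
  have f_ev: "{\<omega>\<in>space M. ?f (X \<omega>) (V \<omega>) = k} \<in> sets M" if "V \<in> borel_measurable M" for V k
  proof -
    note [measurable] = X that
    show ?thesis by measurable
  qed
  \<comment> \<open>\<open>Y\<close> equals the quantile function of (X, U) only almost surely, so
    the events are compared up to null sets.\<close>
  have level: "\<P>(\<omega> in M. Y \<omega> = k) = level_prob k" if "k \<in> {1..K}" for k
    unfolding prob_level_eq[OF XUm XU, symmetric]
    using assms(12) by (intro finite_measure_eq_AE Yev that f_ev U) (auto elim!: eventually_mono)
  have pair: "\<P>(\<omega> in M. Y \<omega> = k \<and> Y' \<omega> = l) = pair_prob k l" if "k \<in> {1..K}" for k l
  proof -
    have Y': "{\<omega>\<in>space M. Y' \<omega> = l} = {\<omega>\<in>space M. ?f (X \<omega>) (U' \<omega>) = l}"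
      using assms(13) by auto
    have "{\<omega>\<in>space M. Y \<omega> = k \<and> Y' \<omega> = l} = {\<omega>\<in>space M. Y \<omega> = k} \<inter> {\<omega>\<in>space M. ?f (X \<omega>) (U' \<omega>) = l}"
      using assms(13) by auto
    moreover have "{\<omega>\<in>space M. ?f (X \<omega>) (U \<omega>) = k \<and> ?f (X \<omega>) (U' \<omega>) = l} =
        {\<omega>\<in>space M. ?f (X \<omega>) (U \<omega>) = k} \<inter> {\<omega>\<in>space M. ?f (X \<omega>) (U' \<omega>) = l}"
      by auto
    ultimately have "\<P>(\<omega> in M. Y \<omega> = k \<and> Y' \<omega> = l) =
        prob {\<omega>\<in>space M. ?f (X \<omega>) (U \<omega>) = k \<and> ?f (X \<omega>) (U' \<omega>) = l}"
      using assms(12) f_ev[OF U, of k] f_ev[OF U', of l] Yev[OF that]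
      by (intro finite_measure_eq_AE) (auto elim!: eventually_mono)
    then show ?thesis unfolding prob_pair_eq[OF XUUm XUU] .
  qed
  have reg: "nn_regular l" if l: "l \<in> {1..K}" for l
    using assms(18)
  proof
    assume a: "AE u in lborel. u \<in> {0<..<1} \<longrightarrow> tendsto_in_prob M
      (\<lambda>n \<omega>. real (?f (Xs (nn_index (\<lambda>i. Xs i \<omega>) n 1) \<omega>) u)) (\<lambda>\<omega>. real (?f (Xs 1 \<omega>) u))"
    \<comment> \<open>A property of Lebesgue-almost every u in (0, 1) holds almost surely under the
      uniform law, the form in which condition (a) is used.\<close>
    have "AE u in PU. tendsto_in_prob M (\<lambda>n \<omega>. real (?f (Xn n 1 \<omega>) u)) (\<lambda>\<omega>. real (?f (Xs 1 \<omega>) u))"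
      unfolding PU_def Xn_def nn_def by (rule AE_uniform_measureI[OF _ a]) simp
    then show ?thesis by (rule nn_regular_if_f_tendsto)
  next
    assume "\<forall>k\<in>{1..K}. AE x in distr M borel X. isCont (Q k) x"
    then have "AE x in PX. isCont (Q l) x" unfolding PX_def using l by blast
    moreover have "AE x in PX. Q l x = q l x" using qQ by eventually_elim (use l in blast)
    ultimately show ?thesis by (intro nn_regular_if_AE_continuous)
  qed
  have "level_prob k > 0" if "k \<in> {1..K}" for k
    using assms(5)[OF that] level[OF that] by simp
  from psi_hat_tendsto[OF reg total this]
  show ?thesis
  proof (rule tendsto_in_prob_cong[rotated 2])
    show "eventually (\<lambda>n. \<forall>\<omega>\<in>space M. psi_hat K (\<lambda>i. Xs i \<omega>) (\<lambda>i. ?f (Xs i \<omega>) (Us i \<omega>)) n =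
        psi_hat K (\<lambda>i. Xs i \<omega>) (\<lambda>i. Ys i \<omega>) n) sequentially"
      using eventually_ge_at_top[of 2]
      by eventually_elim (use assms(16) in \<open>auto intro!: psi_hat_cong\<close>)
    show "1 / (real K - 1) * (\<Sum>k=1..K. \<Sum>l=1..K.
        (pair_prob k l - level_prob k * level_prob l)\<^sup>2 / (level_prob k * level_prob l)) = psi M K Y Y'"
      unfolding psi_def by (intro arg_cong2[where f = "(*)"] sum.cong refl) (simp add: level pair)
  qed
qed

end
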